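(* Let $n\ge 3$ be odd, let $X_n$ be the double regular $n$-gon surface formed from the plane polygons $P_U$ and $P_L$, and let $M_n=\begin{pmatrix}1&2\cot(\pi/n)\\0&1\end{pmatrix}$. Then: (i) there is an affine automorphism of $X_n$ with derivative $M_n$ which acts on each horizontal cylinder of $X_n$ as a single twist (it maps each cylinder to itself, fixing its boundary pointwise, and is a single Dehn twist there); (ii) the linear map $M_n$ of the plane moves the vertices of $P_U$ and $P_L$ horizontally to the corresponding points of the vertex generator guide: for every $j\in\{0,1,\dots,(n-1)/2\}$, $M_n$ takes the left (respectively right) endpoint of the bar $U_{2j}$ to the left (respectively right) endpoint of $U_{2j}'$, and takes the left (respectively right) endpoint of the bar $L_{2j}$ to the left (respectively right) endpoint of $L_{2j}'$.
   Context: Polygons and surface. Let $n\ge3$ be odd. Let $P_U$ be the regular $n$-gon in the plane with unit-length edges, lying in the upper half plane, whose bottom edge is horizontal with endpoints $(0,0)$ and $(1,0)$. Label the bottom edge $S_1$ and the other edges $S_2,\dots,S_n$ counter-clockwise. Let $P_L$ be the reflection of $P_U$ across the line containing $S_n$ (equivalently, the half-turn image of $P_U$ about the midpoint of $S_n$), its edges labeled so that parallel edges of $P_U$ and $P_L$ have the same label. $X_n$ is obtained from $P_U\sqcup P_L$ by identifying edges with the same label by translations. The horizontal cylinders of $X_n$ are the cylinders obtained by cutting $X_n$ along all horizontal segments of $P_U$ and $P_L$ that join vertices. Horizontal bars. Let $U_2,U_4,\dots,U_{n-3}$ be the horizontal diagonals of $P_U$ from lowest to highest, and let $U_{n-1}$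 be the top vertex of $P_U$, regarded as a bar of length $0$. Let $L_2,L_4,\dots,L_{n-3}$ be the horizontal diagonals of $P_L$ from highest to lowest, and let $L_{n-1}$ be the bottom vertex of $P_L$, regarded as a bar of length $0$. Let $U_0$ be the (bottom) edge $S_1$ of $P_U$ and $L_0$ the (top) edge $S_1$ of $P_L$. Vertex generator guide. All copies of polygons are translates with the same edge labels, glued edge-to-edge in the plane: a copy of $P_L$ is glued along edge $S_k$ of a copy of $P_U$ (or vice versa) so that the edges labeled $S_k$ coincide. Upper part: starting with $P_U^{(0)}=P_U$, for $k=2,3,\dots,(n+1)/2$ in order, glue a copy of $P_L$ along edge $S_k$ of $P_U^{(2(k-2))}$, then glue a copy of $P_U$ along edge $S_{n+2-k}$ of this copy of $P_L$, and call this last copy $P_U^{(2(k-1))}$. Lower part: starting with $P_L^{(2)}=P_L$, for $k=3,4,\dots,(n+1)/2$ in order, glue a copy of $P_U$ along edge $S_k$ of $P_L^{(2(k-2))}$, then glue a copy of $P_L$ along edge $S_{n+2-k}$ of this copy of $P_U$, and call this last copy $P_L^{(2(k-1))}$. For $1\le j\le (n-1)/2$, $U_{2j}'$ is the translated bar in $P_U^{(2j)}$ lying in the same horizontal line as $U_{2j}$, and $L_{2j}'$ is the translated bar in $P_L^{(2j)}$ lying in the same horizontal line as $L_{2j}$. Also $U_0'=U_0$, and $L_0'$ is the top edge of the first copy of $P_L$ glued in the upper part (along edge $S_2$ of $P_U$). The vertex generator guide is the set of endpoints of the bars $U_{2j}'$ and $L_{2j}'$. *)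

theory Defs
  imports "HOL-Analysis.Analysis"
begin

section \<open>The two polygons\<close>

type_synonym plane = "real^2"

datatype sheet = Upper | Lower

text \<open>
  The vertices of \<open>P\<^sub>U\<close> in counter-clockwise order, starting with vertex 0 at the origin and
  vertex 1 at \<open>(1,0)\<close>. Edge \<open>S\<^sub>k\<close> (\<open>1 \<le> k \<le> n\<close>) runs from vertex \<open>k - 1\<close> to vertex \<open>k\<close> and has
  direction \<open>2\<pi>(k - 1)/n\<close>; vertex \<open>n\<close> is again vertex 0 (lemma \<open>upper_vertex_n\<close>).
\<close>

definition upper_vertex :: "nat \<Rightarrow> nat \<Rightarrow> plane" where
  "upper_vertex n k =
     (\<Sum>i<k. vector [cos (2 * pi * real i / real n), sin (2 * pi * real i / real n)])"

text \<open>
  \<open>P\<^sub>L\<close> is the image of \<open>P\<^sub>U\<close> under the half-turn about the midpoint of \<open>S\<^sub>n\<close>. A half-turn keeps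
  edge directions, so the image of \<open>S\<^sub>k\<close> is the edge of \<open>P\<^sub>L\<close> that bears the label \<open>k\<close>.
\<close>

definition half_turn :: "nat \<Rightarrow> plane \<Rightarrow> plane" where
  "half_turn n z = 2 *\<^sub>R midpoint (upper_vertex n (n - 1)) (upper_vertex n n) - z"

fun vertex :: "nat \<Rightarrow> sheet \<Rightarrow> nat \<Rightarrow> plane" where
  "vertex n Upper k = upper_vertex n k"
| "vertex n Lower k = half_turn n (upper_vertex n k)"

definition vertices :: "nat \<Rightarrow> sheet \<Rightarrow> plane set" where
  "vertices n s = vertex n s ` {..<n}"

definition polygon :: "nat \<Rightarrow> sheet \<Rightarrow> plane set" where
  "polygon n s = convex hull vertices n s"

definition edge :: "nat \<Rightarrow> sheet \<Rightarrow> nat \<Rightarrow> plane set" where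
  "edge n s k = closed_segment (vertex n s (k - 1)) (vertex n s k)"

text \<open>
  The translation vector that carries edge \<open>S\<^sub>k\<close> of \<open>P\<^sub>L\<close> onto edge \<open>S\<^sub>k\<close> of \<open>P\<^sub>U\<close>. The half-turn
  reverses the direction of travel along the edge, so vertex \<open>k - 1\<close> of \<open>P\<^sub>L\<close> goes to
  vertex \<open>k\<close> of \<open>P\<^sub>U\<close> (and vice versa, see lemma \<open>edge_shift\<close>).
\<close>

definition shift :: "nat \<Rightarrow> nat \<Rightarrow> plane" where
  "shift n k = vertex n Upper k - vertex n Lower (k - 1)"

lemma edge_shift: "(\<lambda>z. z + shift n k) ` edge n Lower k = edge n Upper k"
proof -
  have "(\<lambda>z. z + shift n k) = (+) (shift n k)"
    by (auto simp: add.commute)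
  moreover have "shift n k + vertex n Lower (k - 1) = vertex n Upper k"
    "shift n k + vertex n Lower k = vertex n Upper (k - 1)"
    by (simp_all add: shift_def half_turn_def)
  ultimately show ?thesis
    unfolding edge_def
    by (simp only: closed_segment_translation[symmetric] closed_segment_commute)
qed


section \<open>The surface \<open>X\<^sub>n\<close>\<close>

definition disjoint_polygons :: "nat \<Rightarrow> (sheet \<times> plane) topology" where
  "disjoint_polygons n = sum_topology (\<lambda>s. top_of_set (polygon n s)) UNIV"

definition edge_gluing :: "nat \<Rightarrow> ((sheet \<times> plane) \<times> (sheet \<times> plane)) set" where
  "edge_gluing n =
     {((Lower, z), (Upper, z + shift n k)) | k z. k \<in> {1..n} \<and> z \<in> edge n Lower k}"

text \<open>
  The projection sends a point to its class under the equivalence relation generated by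
  \<open>edge_gluing\<close>.
\<close>

definition proj :: "nat \<Rightarrow> sheet \<times> plane \<Rightarrow> (sheet \<times> plane) set" where
  "proj n p = (edge_gluing n \<union> (edge_gluing n)\<inverse>)\<^sup>* `` {p}"

definition surface :: "nat \<Rightarrow> (sheet \<times> plane) set topology" where
  "surface n = topology (\<lambda>W. W \<subseteq> proj n ` topspace (disjoint_polygons n) \<and>
     openin (disjoint_polygons n) {p \<in> topspace (disjoint_polygons n). proj n p \<in> W})"

lemma openin_surface:
  "openin (surface n) W \<longleftrightarrow> W \<subseteq> proj n ` topspace (disjoint_polygons n) \<and>
     openin (disjoint_polygons n) {p \<in> topspace (disjoint_polygons n). proj n p \<in> W}"
proof -
  have "{p \<in> T. f p \<in> S1 \<inter> S2} = {p \<in> T. f p \<in> S1} \<inter> {p \<in> T. f p \<in> S2}"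
    "{p \<in> T. f p \<in> \<Union>K} = (\<Union>S\<in>K. {p \<in> T. f p \<in> S})"
    for T and f :: "sheet \<times> plane \<Rightarrow> (sheet \<times> plane) set" and S1 S2 K
    by auto
  then have "istopology (\<lambda>W. W \<subseteq> proj n ` topspace (disjoint_polygons n) \<and>
     openin (disjoint_polygons n) {p \<in> topspace (disjoint_polygons n). proj n p \<in> W})"
    unfolding istopology_def by (auto intro!: openin_Int openin_Union)
  then show ?thesis
    by (simp add: surface_def)
qed

lemma topspace_surface: "topspace (surface n) = proj n ` topspace (disjoint_polygons n)"
proof (rule subset_antisym)
  show "topspace (surface n) \<subseteq> proj n ` topspace (disjoint_polygons n)"
    using openin_surface openin_topspace by blast
  have "openin (surface n) (proj n ` topspace (disjoint_polygons n))"
    unfolding openin_surface by (simp add: Collect_mem_eq cong: conj_cong)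
  then show "proj n ` topspace (disjoint_polygons n) \<subseteq> topspace (surface n)"
    by (rule openin_subset)
qed

lemma quotient_map_proj: "quotient_map (disjoint_polygons n) (surface n) (proj n)"
  unfolding quotient_map_def topspace_surface by (auto simp: openin_surface)

definition singularities :: "nat \<Rightarrow> (sheet \<times> plane) set set" where
  "singularities n = proj n ` (SIGMA s:UNIV. vertices n s)"

text \<open>
  The translation structure on the complement of the singularities, given by \<open>n\<close> local
  parametrizations (inverse charts), one for each edge label: place a copy of \<open>P\<^sub>L\<close> next to \<open>P\<^sub>U\<close>
  along \<open>S\<^sub>k\<close>; the interior of the union maps injectively to the surface. The interior consists of
  the interiors of both polygons and of the relative interior of the common edge, so the images
  cover everything except the singularities.
\<close>

definition patch :: "nat \<Rightarrow> nat \<Rightarrow> plane set" where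
  "patch n k = interior (polygon n Upper \<union> (\<lambda>z. z + shift n k) ` polygon n Lower)"

definition patch_map :: "nat \<Rightarrow> nat \<Rightarrow> plane \<Rightarrow> (sheet \<times> plane) set" where
  "patch_map n k z =
     (if z \<in> polygon n Upper then proj n (Upper, z) else proj n (Lower, z - shift n k))"

definition atlas :: "nat \<Rightarrow> (plane set \<times> (plane \<Rightarrow> (sheet \<times> plane) set)) set" where
  "atlas n = {(patch n k, patch_map n k) | k. k \<in> {1..n}}"


section \<open>Affine automorphisms, cylinders and twists\<close>

text \<open>
  In the next three definitions \<open>X\<close> is the surface and \<open>\<A>\<close> a set of local parametrizations
  \<open>(D, \<rho>)\<close>, with \<open>\<rho>\<close> injective on the open plane set \<open>D\<close>.
\<close>

definition affine_automorphism ::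
  "'p topology \<Rightarrow> 'p set \<Rightarrow> (plane set \<times> (plane \<Rightarrow> 'p)) set \<Rightarrow> ('p \<Rightarrow> 'p) \<Rightarrow> real^2^2 \<Rightarrow> bool" where
  "affine_automorphism X \<Sigma> \<A> f A \<longleftrightarrow>
     homeomorphic_map X X f \<and> f ` \<Sigma> = \<Sigma> \<and>
     (\<forall>(D, \<rho>) \<in> \<A>. \<forall>(D', \<rho>') \<in> \<A>. \<forall>z \<in> D. f (\<rho> z) \<in> \<rho>' ` D' \<longrightarrow>
        ((inv_into D' \<rho>' \<circ> f \<circ> \<rho>) has_derivative (\<lambda>x. A *v x)) (at z))"

text \<open>
  \<open>\<Phi>\<close> presents \<open>C\<close> as a horizontal flat cylinder of circumference \<open>c\<close> and height \<open>h\<close>: it is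
  defined on the closed strip of height \<open>h\<close>, is invariant under translation by \<open>(c,0)\<close>, induces a
  bijection from the open strip modulo this translation onto \<open>C\<close>, and is a translation in the local
  coordinates. The closed strip modulo the translation is the cylinder that results from cutting
  the surface; its boundary circles \<open>y = 0\<close> and \<open>y = h\<close> need not map injectively to the surface.
\<close>

definition flat_cylinder ::
  "'p topology \<Rightarrow> (plane set \<times> (plane \<Rightarrow> 'p)) set \<Rightarrow> 'p set \<Rightarrow> real \<Rightarrow> real \<Rightarrow> (plane \<Rightarrow> 'p) \<Rightarrow> bool" where
  "flat_cylinder X \<A> C c h \<Phi> \<longleftrightarrow>
     c > 0 \<and> h > 0 \<and>
     continuous_map (top_of_set {z. 0 \<le> z$2 \<and> z$2 \<le> h}) X \<Phi> \<and>
     (\<forall>z. 0 \<le> z$2 \<and> z$2 \<le> h \<longrightarrow> \<Phi> (z + vector [c, 0]) = \<Phi> z) \<and>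
     \<Phi> ` {z. 0 < z$2 \<and> z$2 < h} = C \<and>
     (\<forall>z w. 0 < z$2 \<and> z$2 < h \<and> 0 < w$2 \<and> w$2 < h \<and> \<Phi> z = \<Phi> w \<longrightarrow>
        (\<exists>m::int. z = w + vector [of_int m * c, 0])) \<and>
     (\<forall>(D, \<rho>) \<in> \<A>. \<forall>z. 0 < z$2 \<and> z$2 < h \<and> \<Phi> z \<in> \<rho> ` D \<longrightarrow>
        ((inv_into D \<rho> \<circ> \<Phi>) has_derivative (\<lambda>x. x)) (at z))"

text \<open>
  In the coordinates of a cylinder, \<open>f\<close> is the single Dehn twist
  \<open>(x, y) \<mapsto> (x + c y / h, y)\<close>: the identity on the boundary circle \<open>y = 0\<close>, one full turn, hence
  again the identity, on the boundary circle \<open>y = h\<close>.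
\<close>

definition single_dehn_twist :: "real \<Rightarrow> real \<Rightarrow> (plane \<Rightarrow> 'p) \<Rightarrow> ('p \<Rightarrow> 'p) \<Rightarrow> bool" where
  "single_dehn_twist c h \<Phi> f \<longleftrightarrow>
     (\<forall>z. 0 \<le> z$2 \<and> z$2 \<le> h \<longrightarrow> f (\<Phi> z) = \<Phi> (z + vector [c * z$2 / h, 0]))"

text \<open>
  A degenerate segment, with equal endpoints, only contributes a vertex of a polygon.
\<close>

definition horizontal_cuts :: "nat \<Rightarrow> (sheet \<times> plane) set set" where
  "horizontal_cuts n = proj n ` {(s, z) | s z. \<exists>a \<in> vertices n s. \<exists>b \<in> vertices n s.
     a$2 = b$2 \<and> z \<in> closed_segment a b}"

text \<open>The horizontal cylinders, without their boundaries.\<close>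

definition horizontal_cylinders :: "nat \<Rightarrow> (sheet \<times> plane) set set set" where
  "horizontal_cylinders n = connected_components_of
     (subtopology (surface n) (topspace (surface n) - horizontal_cuts n))"

definition shear_matrix :: "nat \<Rightarrow> real^2^2" where
  "shear_matrix n = vector [vector [1, 2 * cot (pi / real n)],
                 vector [0, 1]]"


section \<open>Bars and the vertex generator guide\<close>

text \<open>
  \<open>U_left n j\<close> and \<open>U_right n j\<close> are the endpoints of the bar \<open>U\<^bsub>2j\<^esub>\<close>, \<open>0 \<le> j \<le> (n - 1)/2\<close>: the
  bar at level \<open>j\<close> from below joins vertex \<open>n - j\<close> (on the left) to vertex \<open>j + 1\<close> (on the right).
  For \<open>j = 0\<close> this is \<open>S\<^sub>1\<close>, and for \<open>j = (n - 1)/2\<close> both endpoints are the top vertex. The bar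
  \<open>L\<^bsub>2j\<^esub>\<close> is the image of \<open>U\<^bsub>2j\<^esub>\<close> under the half-turn, which exchanges left and right.
\<close>

definition U_left :: "nat \<Rightarrow> nat \<Rightarrow> plane" where
  "U_left n j = vertex n Upper (n - j)"

definition U_right :: "nat \<Rightarrow> nat \<Rightarrow> plane" where
  "U_right n j = vertex n Upper (j + 1)"

definition L_left :: "nat \<Rightarrow> nat \<Rightarrow> plane" where
  "L_left n j = vertex n Lower (j + 1)"

definition L_right :: "nat \<Rightarrow> nat \<Rightarrow> plane" where
  "L_right n j = vertex n Lower (n - j)"

text \<open>
  A copy of a polygon is recorded by its translation vector. \<open>attach_lower n k t\<close> is the copy of
  \<open>P\<^sub>L\<close> glued along edge \<open>S\<^sub>k\<close> to the copy \<open>P\<^sub>U + t\<close>, and \<open>attach_upper n k t\<close> the copy of \<open>P\<^sub>U\<close>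
  glued along edge \<open>S\<^sub>k\<close> to the copy \<open>P\<^sub>L + t\<close>.
\<close>

definition attach_lower :: "nat \<Rightarrow> nat \<Rightarrow> plane \<Rightarrow> plane" where
  "attach_lower n k t = t + shift n k"

definition attach_upper :: "nat \<Rightarrow> nat \<Rightarrow> plane \<Rightarrow> plane" where
  "attach_upper n k t = t - shift n k"

text \<open>
  \<open>upper_guide n j\<close> is the position of \<open>P\<^sub>U\<^bsup>(2j)\<^esup>\<close>; the recursion step from \<open>j\<close> to \<open>j + 1\<close> is the
  step \<open>k = j + 2\<close> of the construction.
\<close>

fun upper_guide :: "nat \<Rightarrow> nat \<Rightarrow> plane" where
  "upper_guide n 0 = 0"
| "upper_guide n (Suc j) =
     (let k = j + 2 in attach_upper n (n + 2 - k) (attach_lower n k (upper_guide n j)))"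

text \<open>
  \<open>lower_guide n j\<close> is the position of \<open>P\<^sub>L\<^bsup>(2j)\<^esup>\<close> for \<open>j \<ge> 1\<close>; the recursion step from \<open>j\<close> to
  \<open>j + 1\<close> is the step \<open>k = j + 2\<close>. The value at \<open>j = 0\<close>, which serves for the bar \<open>L\<^sub>0'\<close>, is the
  position of the first copy of \<open>P\<^sub>L\<close> in the upper part.
\<close>

fun lower_guide :: "nat \<Rightarrow> nat \<Rightarrow> plane" where
  "lower_guide n 0 = attach_lower n 2 (upper_guide n 0)"
| "lower_guide n (Suc 0) = 0"
| "lower_guide n (Suc (Suc j)) =
     (let k = j + 3 in attach_lower n (n + 2 - k) (attach_upper n k (lower_guide n (Suc j))))"

text \<open>
  The endpoints of the bars \<open>U\<^bsub>2j\<^esub>'\<close> and \<open>L\<^bsub>2j\<^esub>'\<close>. The copies \<open>P\<^sub>U\<^bsup>(2j)\<^esup>\<close> and \<open>P\<^sub>L\<^bsup>(2j)\<^esup>\<close> are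
  displaced horizontally (lemma \<open>guide_horizontal\<close>) and the bars lie on distinct levels
  (lemma \<open>bar_levels\<close>), so the bar in the same horizontal line as the original bar is its translate.
\<close>

definition U_left' :: "nat \<Rightarrow> nat \<Rightarrow> plane" where
  "U_left' n j = U_left n j + upper_guide n j"

definition U_right' :: "nat \<Rightarrow> nat \<Rightarrow> plane" where
  "U_right' n j = U_right n j + upper_guide n j"

definition L_left' :: "nat \<Rightarrow> nat \<Rightarrow> plane" where
  "L_left' n j = L_left n j + lower_guide n j"

definition L_right' :: "nat \<Rightarrow> nat \<Rightarrow> plane" where
  "L_right' n j = L_right n j + lower_guide n j"

lemma sin_flip:
  assumes "i \<le> n" "0 < n"
  shows "sin (2 * pi * real (n - i) / real n) = - sin (2 * pi * real i / real n)"
proof -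
  have "2 * pi * real (n - i) / real n = 2 * pi - 2 * pi * real i / real n"
    using assms by (simp add: of_nat_diff field_simps)
  then show ?thesis
    by (simp only: sin_diff) simp
qed

lemma upper_vertex_height:
  "upper_vertex n k $ 2 = (\<Sum>i<k. sin (2 * pi * real i / real n))"
  by (simp add: upper_vertex_def)

lemma bar_horizontal:
  assumes "0 < n" "j < n"
  shows "upper_vertex n (n - j) $ 2 = upper_vertex n (j + 1) $ 2"
  using assms(2)
proof (induction j)
  case 0
  define S where "S = (\<Sum>i\<in>{1..<n}. sin (2 * pi * real i / real n))"
  have "S = (\<Sum>i\<in>{1..<n}. sin (2 * pi * real (n - i) / real n))"
    unfolding S_def by (rule sum.reindex_bij_witness[of _ "\<lambda>i. n - i" "\<lambda>i. n - i"]) auto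
  also have "\<dots> = - S"
    unfolding S_def sum_negf[symmetric] using assms(1) by (intro sum.cong) (auto simp: sin_flip simp del: of_nat_diff)
  finally have "S = 0" by simp
  moreover have "{..<n} = insert 0 {1..<n}" using assms(1) by auto
  ultimately show ?case
    by (simp add: upper_vertex_height S_def)
next
  case (Suc j)
  have "n - j = Suc (n - Suc j)" using Suc.prems by simp
  then have "upper_vertex n (n - j) $ 2
      = upper_vertex n (n - Suc j) $ 2 + sin (2 * pi * real (n - Suc j) / real n)"
    by (simp add: upper_vertex_height)
  then show ?case
    using Suc assms(1) sin_flip[of "Suc j" n] by (simp add: upper_vertex_height)
qed

lemma bar_levels:
  assumes "odd n" "j < (n - 1) div 2"
  shows "U_right n j $ 2 < U_right n (Suc j) $ 2"
proof -
  have *: "2 * (j + 1) < n" using assms by presburger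
  then have "real (2 * (j + 1)) < real n" by (simp only: of_nat_less_iff)
  then have "pi * real (2 * (j + 1)) < pi * real n"
    by (intro mult_strict_left_mono) auto
  then have "2 * pi * real (j + 1) / real n < pi"
    using * by (simp add: field_simps)
  moreover have "0 < 2 * pi * real (j + 1) / real n" using * by simp
  ultimately have "0 < sin (2 * pi * real (j + 1) / real n)" by (rule sin_gt_zero[rotated])
  then show ?thesis
    by (simp add: U_right_def upper_vertex_height)
qed

lemma upper_vertex_n:
  assumes "2 \<le> n"
  shows "upper_vertex n n = 0"
proof -
  define a where "a = pi / real n"
  have "0 < a" "a < pi" using assms by (auto simp: a_def field_simps)
  then have pos: "0 < sin a" by (rule sin_gt_zero)
  have "2 * sin a * (\<Sum>i<n. cos (2 * pi * real i / real n))
      = (\<Sum>i<n. sin (2 * a * real (Suc i) - a) - sin (2 * a * real i - a))"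
    unfolding sum_distrib_left
  proof (rule sum.cong)
    fix i
    have "2 * pi * real i / real n = 2 * a * real i" by (simp add: a_def)
    moreover have "2 * a * real (Suc i) - a = 2 * a * real i + a" by (simp add: algebra_simps)
    ultimately show "2 * sin a * cos (2 * pi * real i / real n)
        = sin (2 * a * real (Suc i) - a) - sin (2 * a * real i - a)"
      by (simp add: sin_add sin_diff)
  qed simp
  also have "\<dots> = sin (2 * a * real n - a) - sin (2 * a * real 0 - a)"
    by (rule sum_lessThan_telescope)
  also have "2 * a * real n = 2 * pi" using assms by (simp add: a_def)
  finally have "(\<Sum>i<n. cos (2 * pi * real i / real n)) = 0"
    using pos by (simp add: sin_diff)
  then have "upper_vertex n n $ 1 = 0" by (simp add: upper_vertex_def)
  moreover have "upper_vertex n n $ 2 = 0"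
    using bar_horizontal[of n 0] assms by (simp add: upper_vertex_height)
  ultimately show ?thesis by (simp add: vec_eq_iff forall_2)
qed

lemma guide_horizontal:
  assumes "odd n" "3 \<le> n" "j \<le> (n - 1) div 2"
  shows "upper_guide n j $ 2 = 0" "1 \<le> j \<Longrightarrow> lower_guide n j $ 2 = 0"
proof -
  have shifts: "shift n (i + 2) $ 2 = shift n (n - i) $ 2" if "i + 1 < n" for i
    using bar_horizontal[of n i] bar_horizontal[of n "i + 1"] that
    by (simp add: shift_def half_turn_def)
  show "upper_guide n j $ 2 = 0"
    using assms(3)
  proof (induction j)
    case (Suc j)
    then have "j + 1 < n" using assms(2) by linarith
    with Suc shifts[of j] show ?case by (simp add: attach_upper_def attach_lower_def)
  qed simp
  show "lower_guide n j $ 2 = 0" if "1 \<le> j"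
    using that assms(3)
  proof (induction j rule: dec_induct)
    case (step j)
    then obtain i where i: "j = Suc i" by (cases j) auto
    have "Suc i + 1 < n" using step.prems assms(2) i by linarith
    then have "shift n (i + 3) $ 2 = shift n (n - Suc i) $ 2"
      using shifts[of "Suc i"] by (simp add: eval_nat_numeral)
    with step i show ?case by (simp add: attach_upper_def attach_lower_def)
  qed simp
qed

end

theory Submission
  imports Defs
begin

text \<open>
  At every level, the part of \<open>P\<^sub>U\<close> between two consecutive bars and the corresponding part of \<open>P\<^sub>L\<close> are
  congruent trapezoids which glue to a flat cylinder. Its circumference is the sum of the lengths of
  the two bars, its height is the vertical distance of the bars, and by the sum formulas for sine the
  quotient is \<open>2 cot (\<pi>/n)\<close> for all levels. Hence the shear by this slope is a single Dehn twist of every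
  cylinder; the twists fix the boundaries and therefore fit together. The same quotient gives part
  (ii): the polygon copies of the guide are displaced by successive circumferences.

  The translation structure is handled through the local exponential map \<open>expo P u\<close>, which moves a
  regular point \<open>P\<close> by a small vector \<open>u\<close>. The charts and the cylinder coordinates both commute with it,
  so that derivatives in charts become identities between points of the surface.
\<close>

text \<open>A point of the surface is a class with several representatives, and \<open>expo\<close>,
  \<open>cyl\<close> and \<open>twist\<close> each select one, by choice or by a floor. The proof
  therefore rests on lemmas that free this selection: \<open>expo_eq\<close>, \<open>cyl_eq\<close>
  and \<open>twist_cyl\<close> allow any representative. The first needs that a regular class has at
  most two elements (\<open>glue_regular\<close>), the last that a point strictly inside a cylinder
  determines its level and its coordinates up to a period (\<open>cyl_eq_cyl\<close>).

  A chart around a point of a cut meets two strips, or the same strip at both ends. Coordinates of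
  charts and strips are never compared there; each is compared with \<open>expo\<close>, which
  belongs to the surface alone.

  Oddness enters twice: the highest bar is a single vertex, so that the last trapezoid is a
  triangle, and no two edges of P_U are parallel, which makes the charts injective.\<close>

lemma vec2_eq_iff: "(z::real^2) = w \<longleftrightarrow> z$1 = w$1 \<and> z$2 = w$2"
  by (simp add: vec_eq_iff forall_2)

lemma closed_segment_horizontal:
  fixes a b z :: "real^2"
  assumes "a$2 = b$2"
  shows "z \<in> closed_segment a b \<longleftrightarrow> z$2 = a$2 \<and> z$1 \<in> closed_segment (a$1) (b$1)"
  using assms by (auto simp: in_segment vec2_eq_iff algebra_simps)

section \<open>The regular polygon: vertices and supporting lines\<close>

locale odd_polygon =
  fixes n :: nat
  assumes odd_n: "odd n" and n_ge_3: "3 \<le> n"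
begin

text \<open>Half the exterior angle: consecutive edges turn by 2 \<alpha>.\<close>

definition \<alpha> :: real where "\<alpha> = pi / real n"

text \<open>The number of cylinders; level \<open>m\<close> is the apex of P_U.\<close>

definition m :: nat where "m = (n - 1) div 2"

abbreviation V :: "nat \<Rightarrow> plane" where "V \<equiv> upper_vertex n"

lemma n_eq: "n = 2 * m + 1" and m_pos: "1 \<le> m"
  using odd_n n_ge_3 unfolding m_def by presburger+

lemma n_alpha: "real n * \<alpha> = pi"
  using n_ge_3 by (simp add: \<alpha>_def)

lemma alpha_pos: "0 < \<alpha>"
  using n_ge_3 by (simp add: \<alpha>_def)

lemma sin_nonneg: "k \<le> n \<Longrightarrow> 0 \<le> sin (real k * \<alpha>)"
proof (rule sin_ge_zero)
  assume "k \<le> n"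
  then have "real k * \<alpha> \<le> real n * \<alpha>"
    using alpha_pos by (intro mult_right_mono) auto
  then show "real k * \<alpha> \<le> pi" by (simp add: n_alpha)
qed (use alpha_pos in auto)

lemma sin_pos: "0 < k \<Longrightarrow> k < n \<Longrightarrow> 0 < sin (real k * \<alpha>)"
proof (rule sin_gt_zero)
  assume "k < n"
  then have "real k * \<alpha> < real n * \<alpha>"
    using alpha_pos by (intro mult_strict_right_mono) auto
  then show "real k * \<alpha> < pi" by (simp add: n_alpha)
qed (use alpha_pos in auto)

lemma sin_alpha_pos: "0 < sin \<alpha>"
  using sin_pos[of 1] n_ge_3 by simp

text \<open>A geometric series: in the complex plane the sum of e^(2 i j \<alpha>) over j < k is sin
  (k \<alpha>) / sin \<alpha> times e^(i (k - 1) \<alpha>). The induction runs with the denominator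
  cleared.\<close>

lemma upper_vertex_closed_form:
  "V k $ 1 = sin (real k * \<alpha>) * cos (real k * \<alpha> - \<alpha>) / sin \<alpha>"
  "V k $ 2 = sin (real k * \<alpha>) * sin (real k * \<alpha> - \<alpha>) / sin \<alpha>"
proof -
  have "sin \<alpha> * V k $ 1 = sin (real k * \<alpha>) * cos (real k * \<alpha> - \<alpha>) \<and>
        sin \<alpha> * V k $ 2 = sin (real k * \<alpha>) * sin (real k * \<alpha> - \<alpha>)"
  proof (induction k)
    case 0
    show ?case by (simp add: upper_vertex_def)
  next
    case (Suc k)
    define x where "x = real k * \<alpha>"
    have x: "2 * pi * real k / real n = 2 * x" "real (Suc k) * \<alpha> = x + \<alpha>"
      by (simp_all add: x_def \<alpha>_def ring_distribs add_divide_distrib)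
    have V: "V (Suc k) = V k + vector [cos (2 * x), sin (2 * x)]"
      by (simp add: upper_vertex_def x[symmetric])
    have s: "sin x * sin x = 1 - cos x * cos x"
      using sin_cos_squared_add[of x] by (simp add: power2_eq_square)
    show ?case
      using Suc unfolding V x(2) x_def[symmetric]
      by (simp add: distrib_left sin_add sin_diff cos_diff cos_double sin_double power2_eq_square)
         (simp add: algebra_simps)
  qed
  then show "V k $ 1 = sin (real k * \<alpha>) * cos (real k * \<alpha> - \<alpha>) / sin \<alpha>"
    "V k $ 2 = sin (real k * \<alpha>) * sin (real k * \<alpha> - \<alpha>) / sin \<alpha>"
    using sin_alpha_pos by (simp_all add: field_simps)
qed

lemma V_0 [simp]: "V 0 = 0" and V_n [simp]: "V n = 0"
  using upper_vertex_n n_ge_3 by (simp_all add: upper_vertex_def)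

text \<open>
  The signed distance to the line of \<open>S\<^sub>l\<close>; all distances from vertices factor into two sines
  (\<open>edge_form_vertex\<close>), from which their signs and zeros can be read off.
\<close>

definition edge_form :: "nat \<Rightarrow> plane \<Rightarrow> real" where
  "edge_form l z = cos (2 * (real l * \<alpha> - \<alpha>)) * z$2 - sin (2 * (real l * \<alpha> - \<alpha>)) * z$1
     + sin (real l * \<alpha>) * sin (real l * \<alpha> - \<alpha>) / sin \<alpha>"

lemma edge_form_convex_comb:
  "edge_form l ((1 - t) *\<^sub>R z + t *\<^sub>R w) = (1 - t) * edge_form l z + t * edge_form l w"
  by (simp add: edge_form_def algebra_simps diff_divide_distrib)

lemma edge_form_vertex:
  "edge_form l (V i) = sin (real i * \<alpha> - real l * \<alpha>) * sin (real i * \<alpha> - real l * \<alpha> + \<alpha>) / sin \<alpha>"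
proof -
  define p q where "p = real i * \<alpha>" and "q = real l * \<alpha>"
  have "cos r * (sin p * s) - sin r * (sin p * c) = sin p * (s * cos r - c * sin r)" for r s c
    by (simp add: algebra_simps)
  then have "cos (2 * (q - \<alpha>)) * (sin p * sin (p - \<alpha>)) - sin (2 * (q - \<alpha>)) * (sin p * cos (p - \<alpha>))
       = sin p * sin ((p - \<alpha>) - 2 * (q - \<alpha>))"
    by (simp only: sin_diff[of "p - \<alpha>"])
  \<comment> \<open>Once the products are differences of cosines, the two terms cos (2 q - \<alpha>)
    cancel.\<close>
  also have "\<dots> + sin q * sin (q - \<alpha>) = sin (p - q) * sin (p - q + \<alpha>)"
    unfolding sin_times_sin by (simp add: field_simps)
  finally show ?thesis
    using sin_alpha_pos
    by (simp add: edge_form_def upper_vertex_closed_form p_def[symmetric] q_def[symmetric] field_simps)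
qed

text \<open>For i < l both sines change sign, so the product survives. Written with natural
  multiples of \<alpha>, the factors fall under \<open>sin_nonneg\<close> and
  \<open>sin_eq_0_iff\<close>.\<close>

lemma edge_form_vertex_nat:
  "l \<le> i \<Longrightarrow> edge_form l (V i) = sin (real (i - l) * \<alpha>) * sin (real (i - l + 1) * \<alpha>) / sin \<alpha>"
  "i < l \<Longrightarrow> edge_form l (V i) = sin (real (l - i) * \<alpha>) * sin (real (l - i - 1) * \<alpha>) / sin \<alpha>"
proof -
  show "edge_form l (V i) = sin (real (i - l) * \<alpha>) * sin (real (i - l + 1) * \<alpha>) / sin \<alpha>" if "l \<le> i"
    unfolding edge_form_vertex using that by (simp add: of_nat_diff algebra_simps)
  show "edge_form l (V i) = sin (real (l - i) * \<alpha>) * sin (real (l - i - 1) * \<alpha>) / sin \<alpha>" if "i < l"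
  proof -
    have *: "real i * \<alpha> - real l * \<alpha> = - (real (l - i) * \<alpha>)"
      "- (real (l - i) * \<alpha>) + \<alpha> = - (real (l - i - 1) * \<alpha>)"
      using that by (simp_all add: of_nat_diff algebra_simps)
    show ?thesis unfolding edge_form_vertex *(1) *(2) by simp
  qed
qed

lemma edge_form_vertex_nonneg:
  assumes "i \<le> n" "1 \<le> l" "l \<le> n"
  shows "0 \<le> edge_form l (V i)"
proof (cases "l \<le> i")
  case True
  then have "i - l \<le> n" "i - l + 1 \<le> n" using assms by auto
  then show ?thesis
    unfolding edge_form_vertex_nat(1)[OF True] using sin_nonneg sin_alpha_pos
    by (metis divide_nonneg_pos mult_nonneg_nonneg)
next
  case False
  then have "i < l" "l - i \<le> n" "l - i - 1 \<le> n" using assms by auto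
  then show ?thesis
    unfolding edge_form_vertex_nat(2)[OF \<open>i < l\<close>] using sin_nonneg sin_alpha_pos
    by (metis divide_nonneg_pos mult_nonneg_nonneg)
qed

lemma sin_eq_0_iff: "k \<le> n \<Longrightarrow> sin (real k * \<alpha>) = 0 \<longleftrightarrow> k = 0 \<or> k = n"
  using sin_pos[of k] n_alpha by (cases "0 < k \<and> k < n") auto

text \<open>The last two alternatives are due to \<open>V 0\<close> and \<open>V n\<close> being the
  same point, the common end of S_1 and S_n.\<close>

lemma edge_form_vertex_eq_0:
  assumes "i \<le> n" "1 \<le> l" "l \<le> n"
  shows "edge_form l (V i) = 0 \<longleftrightarrow> i = l \<or> i = l - 1 \<or> i = n \<and> l = 1 \<or> i = 0 \<and> l = n"
proof (cases "l \<le> i")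
  case True
  then have "i - l \<le> n" "i - l + 1 \<le> n" using assms by auto
  then have "edge_form l (V i) = 0 \<longleftrightarrow> i - l = 0 \<or> i - l = n \<or> i - l + 1 = 0 \<or> i - l + 1 = n"
    unfolding edge_form_vertex_nat(1)[OF True] using sin_eq_0_iff sin_alpha_pos
    by (metis divide_eq_0_iff less_irrefl mult_eq_0_iff)
  then show ?thesis using assms True by auto
next
  case False
  then have "i < l" "l - i \<le> n" "l - i - 1 \<le> n" using assms by auto
  then have "edge_form l (V i) = 0 \<longleftrightarrow> l - i = 0 \<or> l - i = n \<or> l - i - 1 = 0 \<or> l - i - 1 = n"
    unfolding edge_form_vertex_nat(2)[OF \<open>i < l\<close>] using sin_eq_0_iff sin_alpha_pos
    by (metis divide_eq_0_iff less_irrefl mult_eq_0_iff)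
  then show ?thesis using assms False by auto
qed

lemma vertex_in_vertices: "i \<le> n \<Longrightarrow> vertex n s i \<in> vertices n s"
proof -
  assume "i \<le> n"
  have "vertex n s n = vertex n s 0" by (cases s) auto
  then show ?thesis using \<open>i \<le> n\<close> n_ge_3 unfolding vertices_def
    by (cases "i = n") (auto intro!: image_eqI[where x = i] image_eqI[where x = 0])
qed

lemma polygon_convex: "convex (polygon n s)" and polygon_closed: "closed (polygon n s)"
  and vertices_subset: "vertices n s \<subseteq> polygon n s"
proof -
  have "finite (vertices n s)" by (simp add: vertices_def)
  then show "closed (polygon n s)" unfolding polygon_def
    by (simp add: compact_imp_closed finite_imp_compact_convex_hull)
qed (auto simp: polygon_def hull_subset)

lemma edge_subset_polygon: "k \<le> n \<Longrightarrow> edge n s k \<subseteq> polygon n s"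
  unfolding edge_def using vertex_in_vertices[of "k - 1" s] vertex_in_vertices[of k s] vertices_subset
  by (meson closed_segment_subset diff_le_self order_trans polygon_convex subsetD)

lemma edge_form_nonneg:
  assumes "z \<in> polygon n Upper" "1 \<le> l" "l \<le> n"
  shows "0 \<le> edge_form l z"
proof -
  have "convex {z. 0 \<le> edge_form l z}"
    unfolding convex_alt by (auto simp: edge_form_convex_comb)
  moreover have "vertices n Upper \<subseteq> {z. 0 \<le> edge_form l z}"
    using assms by (auto simp: vertices_def edge_form_vertex_nonneg)
  ultimately have "polygon n Upper \<subseteq> {z. 0 \<le> edge_form l z}"
    unfolding polygon_def by (rule hull_minimal[rotated])
  then show ?thesis using assms by auto
qed

lemma edge_form_edge:
  assumes "1 \<le> l" "l \<le> n" "z \<in> edge n Upper l"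
  shows "edge_form l z = 0"
proof -
  have "edge_form l (V (l - 1)) = 0" "edge_form l (V l) = 0"
    using assms by (subst edge_form_vertex_eq_0; force)+
  then show ?thesis using assms(3)
    by (auto simp: edge_def in_segment edge_form_convex_comb)
qed

text \<open>The supporting line cuts out a face, and a face of the hull of a finite set is the hull
  of some of its points; only the two ends of S_l lie on the line.\<close>

lemma mem_edge_if_edge_form_0:
  assumes "z \<in> polygon n Upper" "1 \<le> l" "l \<le> n" "edge_form l z = 0"
  shows "z \<in> edge n Upper l"
proof -
  \<comment> \<open>The inward unit normal of S_l.\<close>
  define nv :: plane where "nv = vector [- sin (2 * (real l * \<alpha> - \<alpha>)), cos (2 * (real l * \<alpha> - \<alpha>))]"
  define b where "b = - (sin (real l * \<alpha>) * sin (real l * \<alpha> - \<alpha>) / sin \<alpha>)"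
  have ef: "edge_form l z = nv \<bullet> z - b" for z
    by (simp add: edge_form_def nv_def b_def inner_vec_def sum_2)
  let ?F = "polygon n Upper \<inter> {x. nv \<bullet> x = b}"
  have "?F face_of polygon n Upper"
    using edge_form_nonneg[OF _ assms(2,3)] polygon_convex
    by (intro face_of_Int_supporting_hyperplane_ge) (auto simp: ef)
  moreover have "compact (vertices n Upper)"
    by (simp add: vertices_def finite_imp_compact)
  ultimately obtain S where S: "S \<subseteq> vertices n Upper" "?F = convex hull S"
    unfolding polygon_def using face_of_convex_hull_subset by metis
  have "S \<subseteq> {V (l - 1), V l}"
  proof
    fix x assume "x \<in> S"
    then have "x \<in> ?F" unfolding S(2) by (rule hull_inc)
    then have "edge_form l x = 0" by (simp add: ef)
    moreover obtain i where "i < n" "x = V i" using S(1) \<open>x \<in> S\<close> by (auto simp: vertices_def)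
    ultimately show "x \<in> {V (l - 1), V l}"
      using edge_form_vertex_eq_0[of i l] assms by auto
  qed
  then have "?F \<subseteq> edge n Upper l"
    unfolding S(2) edge_def segment_convex_hull by (simp add: hull_mono)
  then show ?thesis using assms by (auto simp: ef)
qed

text \<open>Inside S_k the form of S_l is a proper convex combination of its nonnegative values at
  the two ends. If it vanishes, both ends of S_k lie on the line of S_l.\<close>

lemma edge_Int_edge:
  assumes "z \<in> edge n Upper k" "z \<in> edge n Upper l" "z \<notin> vertices n Upper"
    and kl: "1 \<le> k" "k \<le> n" "1 \<le> l" "l \<le> n"
  shows "k = l"
proof -
  obtain t where t: "z = (1 - t) *\<^sub>R V (k - 1) + t *\<^sub>R V k" "0 \<le> t" "t \<le> 1"
    using assms(1) by (auto simp: edge_def in_segment)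
  have "t \<noteq> 0" "t \<noteq> 1"
    using assms(3) t vertex_in_vertices[of "k - 1" Upper] vertex_in_vertices[of k Upper] kl by auto
  have nn: "0 \<le> edge_form l (V (k - 1))" "0 \<le> edge_form l (V k)"
    using kl by (auto intro!: edge_form_vertex_nonneg)
  have "(1 - t) * edge_form l (V (k - 1)) + t * edge_form l (V k) = 0"
    using edge_form_edge[OF kl(3,4) assms(2)] by (simp add: t edge_form_convex_comb)
  then have "(1 - t) * edge_form l (V (k - 1)) = 0" "t * edge_form l (V k) = 0"
    using nn t(2,3) by (simp_all add: add_nonneg_eq_0_iff)
  then have "edge_form l (V (k - 1)) = 0" "edge_form l (V k) = 0"
    using \<open>t \<noteq> 0\<close> \<open>t \<noteq> 1\<close> by auto
  then have "k - 1 = l \<or> k - 1 = l - 1 \<or> k - 1 = n \<and> l = 1 \<or> k - 1 = 0 \<and> l = n"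
    "k = l \<or> k = l - 1 \<or> k = n \<and> l = 1 \<or> k = 0 \<and> l = n"
    using edge_form_vertex_eq_0[of "k - 1" l] edge_form_vertex_eq_0[of k l] kl by auto
  then show ?thesis
    using kl n_ge_3 by (elim disjE; linarith)
qed

lemma vertex_on_edge:
  assumes "z \<in> edge n Upper k" "z \<in> vertices n Upper" "1 \<le> k" "k \<le> n"
  shows "z = V (k - 1) \<or> z = V k"
proof -
  obtain i where i: "i < n" "z = V i" using assms(2) by (auto simp: vertices_def)
  then show ?thesis
    using edge_form_edge[OF assms(3,4,1)] edge_form_vertex_eq_0[of i k] assms(3,4) by auto
qed

section \<open>The half-turn\<close>

abbreviation K :: plane where "K \<equiv> V (n - 1)"

lemma half_turn_eq: "half_turn n z = K - z"
  by (simp add: half_turn_def midpoint_def)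

lemma vertex_Lower: "vertex n Lower k = K - V k"
  by (simp add: half_turn_eq)

lemma shift_eq: "shift n k = V k + V (k - 1) - K"
  by (simp add: shift_def half_turn_eq)

lemma minus_image_eq: "(z::plane) \<in> (\<lambda>w. c - w) ` S \<longleftrightarrow> c - z \<in> S"
  by (auto simp: image_iff) (metis diff_diff_eq2 add_diff_cancel_left')

lemma vertices_Lower: "z \<in> vertices n Lower \<longleftrightarrow> K - z \<in> vertices n Upper"
  unfolding vertices_def using minus_image_eq[of z K "V ` {..<n}"]
  by (simp add: half_turn_eq image_image)

lemma polygon_Lower: "z \<in> polygon n Lower \<longleftrightarrow> K - z \<in> polygon n Upper"
proof -
  have "vertices n Lower = (\<lambda>w. K - w) ` vertices n Upper"
    unfolding vertices_def by (auto simp: half_turn_eq)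
  also have "\<dots> = (+) K ` uminus ` vertices n Upper"
    unfolding image_image by simp
  finally have "polygon n Lower = (+) K ` uminus ` polygon n Upper"
    unfolding polygon_def
    by (simp add: convex_hull_translation convex_hull_linear_image linear_uminus)
  also have "\<dots> = (\<lambda>w. K - w) ` polygon n Upper"
    unfolding image_image by simp
  finally show ?thesis using minus_image_eq by simp
qed

lemma edge_Lower: "z \<in> edge n Lower k \<longleftrightarrow> z + shift n k \<in> edge n Upper k"
proof -
  have "inj (\<lambda>z. z + shift n k)" by (simp add: inj_on_def)
  then show ?thesis
    unfolding edge_shift[symmetric] by (rule inj_image_mem_iff[symmetric])
qed

lemma edge_point_reflection: "z \<in> edge n Upper k \<longleftrightarrow> V (k - 1) + V k - z \<in> edge n Upper k"
proof -
  have "V (k - 1) + V k - z \<in> edge n Upper k" if z: "z \<in> edge n Upper k" for z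
  proof -
    obtain t where t: "z = (1 - t) *\<^sub>R V (k - 1) + t *\<^sub>R V k" "0 \<le> t" "t \<le> 1"
      using z unfolding edge_def in_segment vertex.simps by blast
    have "V (k - 1) + V k - z = (1 - (1 - t)) *\<^sub>R V (k - 1) + (1 - t) *\<^sub>R V k"
      by (simp add: t algebra_simps)
    then show ?thesis
      using t(2,3) unfolding edge_def in_segment vertex.simps
      by (intro exI[of _ "1 - t"]) auto
  qed
  from this[of z] this[of "V (k - 1) + V k - z"] show ?thesis by auto
qed

text \<open>The half-turn and the gluing translation carry an edge of P_L to the same edge of P_U;
  they differ by the reflection of that edge in its midpoint.\<close>

lemma edge_Lower': "z \<in> edge n Lower k \<longleftrightarrow> K - z \<in> edge n Upper k"
  unfolding edge_Lower by (subst edge_point_reflection) (simp add: shift_eq algebra_simps)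

text \<open>A vertex on an edge is one of its ends, and the gluing carries ends to ends. Hence being
  singular does not depend on the representative.\<close>

lemma vertices_shift:
  assumes "z \<in> edge n Lower k" "1 \<le> k" "k \<le> n"
  shows "z + shift n k \<in> vertices n Upper \<longleftrightarrow> z \<in> vertices n Lower"
proof
  assume "z + shift n k \<in> vertices n Upper"
  then have "z + shift n k = V (k - 1) \<or> z + shift n k = V k"
    using assms vertex_on_edge edge_Lower by blast
  then have "K - z = V k \<or> K - z = V (k - 1)" by (auto simp: shift_eq algebra_simps)
  then show "z \<in> vertices n Lower"
    unfolding vertices_Lower using vertex_in_vertices[of k Upper] vertex_in_vertices[of "k - 1" Upper] assms
    by auto
next
  assume "z \<in> vertices n Lower"
  then have "K - z = V (k - 1) \<or> K - z = V k"
    using assms vertex_on_edge edge_Lower' vertices_Lower by blast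
  then have "z + shift n k = V k \<or> z + shift n k = V (k - 1)" by (auto simp: shift_eq algebra_simps)
  then show "z + shift n k \<in> vertices n Upper"
    using vertex_in_vertices[of k Upper] vertex_in_vertices[of "k - 1" Upper] assms
    by auto
qed

section \<open>Levels\<close>

text \<open>\<open>width j\<close> is the length of the bar at level j (\<open>V_left_right\<close>)
  and \<open>H j\<close> its height. The vector (\<kappa> j, ht j) is the unit vector along S_(j+2),
  the right leg of the trapezoid above this bar; \<open>\<kappa> j\<close> is negative where the
  polygon narrows.\<close>

definition width :: "nat \<Rightarrow> real" where "width j = sin (real (2 * j + 1) * \<alpha>) / sin \<alpha>"
definition ht :: "nat \<Rightarrow> real" where "ht j = sin (real (2 * (j + 1)) * \<alpha>)"
definition \<kappa> :: "nat \<Rightarrow> real" where "\<kappa> j = cos (real (2 * (j + 1)) * \<alpha>)"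
definition circ :: "nat \<Rightarrow> real" where "circ j = width j + width (Suc j)"
definition H :: "nat \<Rightarrow> real" where "H j = V (Suc j) $ 2"

lemma width_0: "width 0 = 1"
  using sin_alpha_pos by (simp add: width_def)

text \<open>With x = 2 (j + 1) \<alpha> this is sin (x + \<alpha>) - sin (x - \<alpha>) = 2 cos x
  sin \<alpha>; each of the two legs contributes one \<open>\<kappa> j\<close>.\<close>

lemma width_Suc: "width (Suc j) = width j + 2 * \<kappa> j"
proof -
  define x where "x = real (2 * (j + 1)) * \<alpha>"
  have "real (2 * j + 1) * \<alpha> = x - \<alpha>" "real (2 * Suc j + 1) * \<alpha> = x + \<alpha>"
    by (simp_all add: x_def algebra_simps)
  then have w: "width j = sin (x - \<alpha>) / sin \<alpha>" "width (Suc j) = sin (x + \<alpha>) / sin \<alpha>"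
    unfolding width_def by (simp_all only:)
  then show ?thesis
    using sin_alpha_pos unfolding w \<kappa>_def x_def[symmetric]
    by (simp add: sin_add sin_diff field_simps)
qed

lemma circ_eq: "circ j = 2 * width j + 2 * \<kappa> j"
  by (simp add: circ_def width_Suc)

text \<open>The two widths are sin (x - \<alpha>) / sin \<alpha> and sin (x + \<alpha>) / sin
  \<alpha> with sum 2 cos \<alpha> sin x / sin \<alpha>, while \<open>ht j\<close> is sin x.\<close>

lemma circ_ht: "circ j = 2 * cot \<alpha> * ht j"
proof -
  define x where "x = real (2 * (j + 1)) * \<alpha>"
  have "real (2 * j + 1) * \<alpha> = x - \<alpha>" "real (2 * Suc j + 1) * \<alpha> = x + \<alpha>"
    by (simp_all add: x_def algebra_simps)
  then have w: "width j = sin (x - \<alpha>) / sin \<alpha>" "width (Suc j) = sin (x + \<alpha>) / sin \<alpha>"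
    unfolding width_def by (simp_all only:)
  then show ?thesis
    using sin_alpha_pos unfolding circ_def w ht_def x_def[symmetric]
    by (simp add: sin_add sin_diff cot_def field_simps)
qed

lemma width_nonneg: "j \<le> m \<Longrightarrow> 0 \<le> width j"
  unfolding width_def using n_eq by (intro divide_nonneg_pos sin_nonneg sin_alpha_pos) auto

lemma width_pos: "j < m \<Longrightarrow> 0 < width j"
  unfolding width_def using n_eq by (intro divide_pos_pos sin_pos sin_alpha_pos) auto

lemma width_m: "width m = 0"
  using n_alpha unfolding width_def n_eq[symmetric] by simp

lemma ht_pos: "j < m \<Longrightarrow> 0 < ht j"
  unfolding ht_def using n_eq by (intro sin_pos) auto

lemma circ_pos: "j < m \<Longrightarrow> 0 < circ j"
  unfolding circ_def using width_pos[of j] width_nonneg[of "Suc j"] by simp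

lemma V_right: "V (Suc (Suc j)) = V (Suc j) + vector [\<kappa> j, ht j]"
proof -
  have "2 * pi * real (Suc j) / real n = real (2 * (j + 1)) * \<alpha>"
    by (simp add: \<alpha>_def)
  then show ?thesis unfolding \<kappa>_def ht_def
    by (metis (no_types, lifting) sum.lessThan_Suc upper_vertex_def)
qed

lemma V_left:
  assumes "j < n"
  shows "V (n - Suc j) = V (n - j) + vector [- \<kappa> j, ht j]"
proof -
  define x where "x = real (2 * (j + 1)) * \<alpha>"
  have "n - j = Suc (n - Suc j)" using assms by simp
  then have "V (n - j) = V (n - Suc j) + vector [cos (2 * pi * real (n - Suc j) / real n), sin (2 * pi * real (n - Suc j) / real n)]"
    by (metis (no_types, lifting) sum.lessThan_Suc upper_vertex_def)
  moreover have "2 * pi * real (n - Suc j) / real n = 2 * pi - x"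
    using assms by (simp add: \<alpha>_def x_def of_nat_diff field_simps)
  then have "cos (2 * pi * real (n - Suc j) / real n) = \<kappa> j" "sin (2 * pi * real (n - Suc j) / real n) = - ht j"
    by (simp_all add: cos_diff sin_diff \<kappa>_def ht_def x_def)
  ultimately show ?thesis by (simp add: vec2_eq_iff)
qed

text \<open>Climbing one level moves the right end by (\<kappa> j, ht j) and the left end by (-
  \<kappa> j, ht j), so the bar stays horizontal and grows as in \<open>width_Suc\<close>.\<close>

lemma V_left_right: "j < n \<Longrightarrow> V (Suc j) = V (n - j) + vector [width j, 0]"
proof (induction j)
  case 0
  have "V (Suc 0) = vector [1, 0]" by (simp add: upper_vertex_def)
  then show ?case by (simp add: width_0)
next
  case (Suc j)
  then show ?case
    unfolding V_right V_left[OF Suc_lessD[OF Suc.prems]]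
    by (simp add: vec2_eq_iff width_Suc)
qed

lemma V_left_height: "j < n \<Longrightarrow> V (n - j) $ 2 = H j"
  using V_left_right[of j] by (simp add: H_def)

lemma H_0: "H 0 = 0"
  by (simp add: H_def upper_vertex_def)

lemma H_Suc: "H (Suc j) = H j + ht j"
  by (simp add: H_def V_right)

lemma H_less: "j < k \<Longrightarrow> k \<le> m \<Longrightarrow> H j < H k"
proof (induction k)
  case (Suc k)
  then have "0 < ht k" by (intro ht_pos) simp
  then show ?case using Suc by (cases "j = k") (auto simp: H_Suc)
qed simp

lemma H_le: "j \<le> k \<Longrightarrow> k \<le> m \<Longrightarrow> H j \<le> H k"
  using H_less[of j k] by (cases "j = k") auto

text \<open>The first band is open and the second closed: a height strictly inside one band meets no
  other, not even its boundary. \<open>cyl_eq_cyl\<close> needs this asymmetry.\<close>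

lemma H_level_unique:
  assumes "H j < y" "y < H (Suc j)" "H k \<le> y" "y \<le> H (Suc k)" "j < m" "k < m"
  shows "j = k"
proof (rule ccontr)
  assume "j \<noteq> k"
  then consider "Suc j \<le> k" | "Suc k \<le> j" by linarith
  then show False
    using H_le[of "Suc j" k] H_le[of "Suc k" j] assms by cases auto
qed

lemma H_not_level:
  assumes "H j < H i" "H i < H (Suc j)" "j < m" "i \<le> m"
  shows False
proof -
  consider "i \<le> j" | "Suc j \<le> i" by linarith
  then show False
    using H_le[of i j] H_le[of "Suc j" i] assms by cases auto
qed

lemma vertex_height:
  assumes "z \<in> vertices n Upper"
  obtains j where "j \<le> m" "z$2 = H j" "z = V (Suc j) \<or> z = V (n - j)"
proof -
  obtain i where i: "i < n" "z = V i" using assms by (auto simp: vertices_def)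
  consider "i = 0" | "1 \<le> i" "i \<le> m + 1" | "m + 1 < i" by linarith
  then show thesis
  proof cases
    case 1
    \<comment> \<open>Vertex 0 is the left end of level 0 under its other index n.\<close>
    then show thesis using that[of 0] i by (simp add: H_0)
  next
    case 2
    then show thesis using that[of "i - 1"] i by (simp add: H_def)
  next
    case 3
    then show thesis using that[of "n - i"] i V_left_height[of "n - i"] n_eq by simp
  qed
qed

lemma Upper_height:
  assumes "z \<in> polygon n Upper"
  shows "0 \<le> z$2" "z$2 \<le> H m"
proof -
  have "vertices n Upper \<subseteq> {z. 0 \<le> z$2} \<inter> {z. z$2 \<le> H m}"
  proof
    fix z assume "z \<in> vertices n Upper"
    then obtain j where "j \<le> m" "z$2 = H j" by (rule vertex_height)
    then show "z \<in> {z. 0 \<le> z$2} \<inter> {z. z$2 \<le> H m}"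
      using H_le[of 0 j] H_le[of j m] by (simp add: H_0)
  qed
  moreover have "convex ({z::plane. 0 \<le> z$2} \<inter> {z. z$2 \<le> H m})"
    by (intro convex_Int) (auto intro!: convexI add_mono convex_bound_le)
  ultimately have "polygon n Upper \<subseteq> {z. 0 \<le> z$2} \<inter> {z. z$2 \<le> H m}"
    unfolding polygon_def by (rule hull_minimal)
  then show "0 \<le> z$2" "z$2 \<le> H m" using assms by auto
qed

text \<open>At the height of a bar this picks the band above it, and \<open>level_ex_upper\<close>
  the band below; \<open>regular_point_cases\<close> uses both.\<close>

lemma level_ex_lower:
  assumes "0 \<le> y" "y < H m"
  shows "\<exists>j<m. H j \<le> y \<and> y < H (Suc j)"
proof -
  have "\<exists>j<k. H j \<le> y \<and> y < H (Suc j)" if "y < H k" for k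
    using that
  proof (induction k)
    case (Suc k)
    then show ?case by (cases "y < H k") (auto intro: less_SucI)
  qed (use assms in \<open>simp add: H_0\<close>)
  then show ?thesis using assms by blast
qed

lemma level_ex_upper:
  assumes "0 < y" "y \<le> H m"
  shows "\<exists>j<m. H j < y \<and> y \<le> H (Suc j)"
proof -
  have "\<exists>j<k. H j < y \<and> y \<le> H (Suc j)" if "y \<le> H k" for k
    using that
  proof (induction k)
    case (Suc k)
    then show ?case by (cases "y \<le> H k") (auto intro: less_SucI)
  qed (use assms in \<open>simp add: H_0\<close>)
  then show ?thesis using assms by blast
qed

text \<open>S_(n-j) is the left leg of the trapezoid at level j, and S_(j+2) in the next lemma the
  right one. The constant term is eliminated by subtracting the zero value at the lower end of the
  leg.\<close>

lemma edge_form_left: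
  assumes "j < m"
  shows "edge_form (n - j) z = \<kappa> j * (z$2 - H j) + ht j * (z$1 - V (n - j) $ 1)"
proof -
  have j: "j < n" "1 \<le> n - j" using assms n_eq by auto
  have "edge_form (n - j) (V (n - j)) = 0"
    using j by (subst edge_form_vertex_eq_0) auto
  moreover have "2 * (real (n - j) * \<alpha> - \<alpha>) = 2 * pi - real (2 * (j + 1)) * \<alpha>"
    using j n_alpha by (simp add: of_nat_diff algebra_simps)
  then have "cos (2 * (real (n - j) * \<alpha> - \<alpha>)) = \<kappa> j" "sin (2 * (real (n - j) * \<alpha> - \<alpha>)) = - ht j"
    by (simp_all only: cos_diff sin_diff \<kappa>_def ht_def) simp_all
  ultimately show ?thesis
    unfolding edge_form_def using V_left_height[OF j(1)] by (simp add: algebra_simps)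
qed

lemma edge_form_right:
  assumes "j < m"
  shows "edge_form (j + 2) z = \<kappa> j * (z$2 - H j) - ht j * (z$1 - V (Suc j) $ 1)"
proof -
  have j: "j + 2 \<le> n" using assms n_eq by auto
  have "edge_form (j + 2) (V (Suc j)) = 0"
    using j by (subst edge_form_vertex_eq_0) auto
  moreover have "2 * (real (j + 2) * \<alpha> - \<alpha>) = real (2 * (j + 1)) * \<alpha>"
    by (simp add: algebra_simps)
  ultimately show ?thesis
    unfolding edge_form_def \<kappa>_def ht_def H_def by (simp add: algebra_simps)
qed

section \<open>The strip\<close>

text \<open>
  Cylinder coordinates at level \<open>j\<close>: the origin is the left endpoint of \<open>U\<^bsub>2j\<^esub>\<close>, and the trapezoid of
  \<open>P\<^sub>L\<close> stands to the right of the one of \<open>P\<^sub>U\<close>, glued along \<open>S\<^bsub>j+2\<^esub>\<close>. The slanted sides are written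
  without division by \<open>ht j\<close>.
\<close>

definition strip :: "nat \<Rightarrow> plane set" where
  "strip j = {z. 0 \<le> z$2 \<and> z$2 \<le> ht j}"

fun piece :: "nat \<Rightarrow> sheet \<Rightarrow> plane set" where
  "piece j Upper = {z \<in> strip j. - \<kappa> j * z$2 \<le> ht j * z$1 \<and> ht j * z$1 \<le> ht j * width j + \<kappa> j * z$2}"
| "piece j Lower = {z \<in> strip j. ht j * width j + \<kappa> j * z$2 \<le> ht j * z$1 \<and> ht j * z$1 \<le> ht j * circ j - \<kappa> j * z$2}"

fun offset :: "nat \<Rightarrow> sheet \<Rightarrow> plane" where
  "offset j Upper = - V (n - j)"
| "offset j Lower = shift n (j + 2) - V (n - j)"

text \<open>In P_L this is the depth below the top edge, the height of the half-turned point, so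
  that both polygons have their bars at the values \<open>H j\<close>.\<close>

fun level :: "sheet \<Rightarrow> plane \<Rightarrow> real" where
  "level Upper z = z$2"
| "level Lower z = K$2 - z$2"

definition trap :: "nat \<Rightarrow> sheet \<Rightarrow> plane set" where
  "trap j s = {z \<in> polygon n s. H j \<le> level s z \<and> level s z \<le> H (Suc j)}"

lemma left_edge_point:
  assumes j: "j < m" and z: "0 \<le> y" "y \<le> ht j" and x: "ht j * x = - \<kappa> j * y"
  shows "V (n - j) + vector [x, y] \<in> edge n Upper (n - j)"
proof -
  have "j < n" using j n_eq by simp
  define t where "t = 1 - y / ht j"
  have h: "0 < ht j" using j by (rule ht_pos)
  have x': "x = - \<kappa> j * y / ht j" using x h by (simp add: field_simps)
  have "0 \<le> t" "t \<le> 1" using z h by (auto simp: t_def field_simps)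
  moreover have "V (n - j) + vector [x, y] = (1 - t) *\<^sub>R V (n - Suc j) + t *\<^sub>R V (n - j)"
    unfolding V_left[OF \<open>j < n\<close>] using h by (simp add: vec2_eq_iff t_def x' algebra_simps)
  ultimately show ?thesis
    unfolding edge_def in_segment by (auto intro!: exI[of _ t])
qed

lemma right_edge_point:
  assumes j: "j < m" and z: "0 \<le> y" "y \<le> ht j" and x: "ht j * x = ht j * width j + \<kappa> j * y"
  shows "V (n - j) + vector [x, y] \<in> edge n Upper (j + 2)"
proof -
  have "j < n" using j n_eq by simp
  define t where "t = y / ht j"
  have h: "0 < ht j" using j by (rule ht_pos)
  have x': "x = width j + \<kappa> j * y / ht j" using x h by (simp add: field_simps)
  have "0 \<le> t" "t \<le> 1" using z h by (auto simp: t_def field_simps)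
  moreover have "V (n - j) + vector [x, y] = (1 - t) *\<^sub>R V (Suc j) + t *\<^sub>R V (Suc (Suc j))"
    unfolding V_right V_left_right[OF \<open>j < n\<close>] using h
    by (simp add: vec2_eq_iff t_def x' algebra_simps)
  ultimately show ?thesis
    unfolding edge_def in_segment by (auto intro!: exI[of _ t])
qed

text \<open>The edge forms of the two legs give the slanted inequalities. Conversely, by convexity:
  the point lies on the horizontal segment between the points of the two legs at its height.\<close>

lemma piece_Upper_iff:
  assumes j: "j < m"
  shows "z \<in> piece j Upper \<longleftrightarrow> z - offset j Upper \<in> trap j Upper"
proof
  have jn: "j < n" "1 \<le> n - j" "n - j \<le> n" "1 \<le> j + 2" "j + 2 \<le> n" using j n_eq by auto
  define q where "q = V (n - j) + z"
  have q: "z - offset j Upper = q" "q$2 = H j + z$2" "q$1 = V (n - j) $ 1 + z$1"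
    "V (Suc j) $ 1 = V (n - j) $ 1 + width j"
    using V_left_height[OF jn(1)] V_left_right[OF jn(1)] by (simp_all add: q_def)
  have h: "0 < ht j" using j by (rule ht_pos)
  {
    assume "z - offset j Upper \<in> trap j Upper"
    then have t: "q \<in> polygon n Upper" "H j \<le> q$2" "q$2 \<le> H (Suc j)"
      unfolding trap_def q(1) by simp_all
    show "z \<in> piece j Upper"
      using edge_form_nonneg[OF t(1) jn(2,3)] edge_form_nonneg[OF t(1) jn(4,5)] t(2,3)
      unfolding edge_form_left[OF j] edge_form_right[OF j]
      by (simp add: strip_def q H_Suc algebra_simps)
  }
  assume p: "z \<in> piece j Upper"
  define y where "y = z$2"
  have y: "0 \<le> y" "y \<le> ht j" using p by (auto simp: strip_def y_def)
  define l r where "l = - \<kappa> j * y / ht j" and "r = width j + \<kappa> j * y / ht j"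
  have lr: "ht j * l = - \<kappa> j * y" "ht j * r = ht j * width j + \<kappa> j * y"
    using h by (simp_all add: l_def r_def field_simps)
  have "V (n - j) + vector [l, y] \<in> polygon n Upper" "V (n - j) + vector [r, y] \<in> polygon n Upper"
    using left_edge_point[OF j y lr(1)] right_edge_point[OF j y lr(2)] edge_subset_polygon jn by blast+
  then have "closed_segment (V (n - j) + vector [l, y]) (V (n - j) + vector [r, y]) \<subseteq> polygon n Upper"
    by (intro closed_segment_subset polygon_convex)
  moreover have "l \<le> z$1" "z$1 \<le> r"
    using p h by (auto simp: l_def r_def y_def field_simps)
  then have "q \<in> closed_segment (V (n - j) + vector [l, y]) (V (n - j) + vector [r, y])"
    by (subst closed_segment_horizontal) (auto simp: closed_segment_eq_real_ivl q_def y_def)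
  ultimately show "z - offset j Upper \<in> trap j Upper"
    using y q by (auto simp: trap_def H_Suc y_def)
qed

text \<open>The half-turn about the midpoint (width j + \<kappa> j / 2, ht j / 2) of the common leg
  S_(j+2) exchanges the two trapezoids.\<close>

lemma piece_Lower_reflect:
  "z \<in> piece j Lower \<longleftrightarrow> vector [2 * width j + \<kappa> j - z$1, ht j - z$2] \<in> piece j Upper"
  by (auto simp: strip_def circ_eq algebra_simps)

lemma piece_iff:
  assumes j: "j < m"
  shows "z \<in> piece j s \<longleftrightarrow> z - offset j s \<in> trap j s"
proof (cases s)
  case Upper
  then show ?thesis using piece_Upper_iff[OF j] by simp
next
  case Lower
  have jn: "j < n" using j n_eq by auto
  define z' :: plane where "z' = vector [2 * width j + \<kappa> j - z$1, ht j - z$2]"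
  have "K - (z - offset j Lower) = z' - offset j Upper"
    using V_left_right[OF jn] V_right[of j] by (simp add: vec2_eq_iff z'_def shift_eq)
  then have "z - offset j Lower \<in> polygon n Lower \<longleftrightarrow> z' - offset j Upper \<in> polygon n Upper"
    "level Lower (z - offset j Lower) = level Upper (z' - offset j Upper)"
    by (simp_all only: polygon_Lower level.simps vector_minus_component[symmetric])
  then have "z - offset j Lower \<in> trap j Lower \<longleftrightarrow> z' - offset j Upper \<in> trap j Upper"
    by (simp only: trap_def mem_Collect_eq)
  then show ?thesis
    using piece_Upper_iff[OF j, of z'] Lower piece_Lower_reflect[of z j] by (simp only: z'_def)
qed

section \<open>Points of the surface\<close>

definition glue :: "((sheet \<times> plane) \<times> (sheet \<times> plane)) set" where
  "glue = edge_gluing n \<union> (edge_gluing n)\<inverse>"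

lemma proj_eq_iff: "proj n p = proj n q \<longleftrightarrow> (p, q) \<in> glue\<^sup>*"
proof -
  have "sym (glue\<^sup>*)" by (simp add: glue_def sym_Un_converse sym_rtrancl)
  then show ?thesis
    unfolding proj_def glue_def[symmetric]
    by (auto dest: symD intro: rtrancl_trans)
qed

lemma glue_iff:
  "((s, w), (s', w')) \<in> glue \<longleftrightarrow>
    (\<exists>k\<in>{1..n}. s = Upper \<and> s' = Lower \<and> w \<in> edge n Upper k \<and> w' = w - shift n k \<or>
       s = Lower \<and> s' = Upper \<and> w \<in> edge n Lower k \<and> w' = w + shift n k)"
  by (auto simp: glue_def edge_gluing_def edge_Lower)

lemma proj_edge:
  assumes "w \<in> edge n Upper k" "1 \<le> k" "k \<le> n"
  shows "proj n (Upper, w) = proj n (Lower, w - shift n k)"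
  using assms by (auto simp: proj_eq_iff glue_iff intro!: r_into_rtrancl bexI[of _ k])

lemma edge_Int_edge_Lower:
  assumes "z \<in> edge n Lower k" "z \<in> edge n Lower l" "z \<notin> vertices n Lower"
    and kl: "1 \<le> k" "k \<le> n" "1 \<le> l" "l \<le> n"
  shows "k = l"
  using assms edge_Int_edge[of "K - z"] by (simp add: edge_Lower' vertices_Lower)

lemma glue_vertices:
  assumes "((s, w), (t, v)) \<in> glue"
  shows "w \<in> vertices n s \<longleftrightarrow> v \<in> vertices n t"
proof -
  obtain k where k: "1 \<le> k" "k \<le> n"
    "s = Upper \<and> t = Lower \<and> w \<in> edge n Upper k \<and> w = v + shift n k \<or>
       s = Lower \<and> t = Upper \<and> w \<in> edge n Lower k \<and> v = w + shift n k"
    using assms by (auto simp: glue_iff)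
  then show ?thesis
    using vertices_shift[of w k] vertices_shift[of v k] by (auto simp: edge_Lower)
qed

text \<open>A point that is not a vertex lies on at most one edge, so the second gluing step undoes
  the first.\<close>

lemma glue_back:
  assumes "((s, w), (s', w')) \<in> glue" "((s', w'), (t, v)) \<in> glue" "w' \<notin> vertices n s'"
  shows "t = s \<and> v = w"
proof (cases s')
  case Upper
  then obtain k l where "s = Lower" "t = Lower" "w \<in> edge n Lower k" "w' = w + shift n k"
    "w' \<in> edge n Upper l" "v = w' - shift n l" "1 \<le> k" "k \<le> n" "1 \<le> l" "l \<le> n"
    using assms(1,2) by (auto simp: glue_iff)
  then show ?thesis
    using edge_Int_edge[of w' k l] edge_Lower[of w k] assms(3) Upper by auto
next
  case Lower
  then obtain k l where "s = Upper" "t = Upper" "w \<in> edge n Upper k" "w' = w - shift n k"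
    "w' \<in> edge n Lower l" "v = w' + shift n l" "1 \<le> k" "k \<le> n" "1 \<le> l" "l \<le> n"
    using assms(1,2) by (auto simp: glue_iff)
  then show ?thesis
    using edge_Int_edge_Lower[of w' k l] edge_Lower[of w' k] assms(3) Lower by auto
qed

text \<open>By \<open>glue_back\<close> a chain of gluings from a regular point collapses to at most
  one step.\<close>

lemma glue_regular:
  assumes "(p, q) \<in> glue\<^sup>*" "snd p \<notin> vertices n (fst p)"
  shows "snd q \<notin> vertices n (fst q) \<and> (q = p \<or> (p, q) \<in> glue)"
  using assms(1)
proof (induction rule: rtrancl_induct)
  case (step q r)
  obtain s w s' w' t v where pqr: "p = (s, w)" "q = (s', w')" "r = (t, v)"
    by (metis surj_pair)
  have v: "v \<notin> vertices n t"
    using step glue_vertices pqr by auto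
  show ?case
  proof (cases "q = p")
    case True
    then show ?thesis using step v pqr by auto
  next
    case False
    then have pq: "(p, q) \<in> glue" using step by auto
    have w': "w' \<notin> vertices n s'" using step pqr by auto
    have "r = p"
      using glue_back[OF pq[unfolded pqr] step(2)[unfolded pqr] w'] pqr by simp
    then show ?thesis using v pqr by auto
  qed
qed (use assms in auto)

lemma proj_same_sheet:
  assumes "proj n (s, w) = proj n (s, w')" "w \<notin> vertices n s"
  shows "w = w'"
  using glue_regular[of "(s, w)" "(s, w')"] assms by (auto simp: proj_eq_iff glue_iff)

lemma proj_other_sheet:
  assumes "proj n (Upper, w) = proj n (Lower, w')" "w \<notin> vertices n Upper \<or> w' \<notin> vertices n Lower"
  obtains k where "1 \<le> k" "k \<le> n" "w \<in> edge n Upper k" "w' = w - shift n k"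
proof (cases "w \<in> vertices n Upper")
  case False
  then have "((Upper, w), (Lower, w')) \<in> glue"
    using glue_regular[of "(Upper, w)" "(Lower, w')"] assms by (auto simp: proj_eq_iff)
  then show thesis using that by (auto simp: glue_iff)
next
  case True
  then have "((Lower, w'), (Upper, w)) \<in> glue"
    using glue_regular[of "(Lower, w')" "(Upper, w)"] assms by (auto simp: proj_eq_iff[symmetric])
  then show thesis using that by (auto simp: glue_iff edge_Lower)
qed

lemma singular_iff: "proj n (s, w) \<in> singularities n \<longleftrightarrow> w \<in> vertices n s"
proof
  assume "proj n (s, w) \<in> singularities n"
  then obtain s' w' where "proj n (s, w) = proj n (s', w')" "w' \<in> vertices n s'"
    by (auto simp: singularities_def)
  then show "w \<in> vertices n s"
    using glue_regular[of "(s, w)" "(s', w')"] by (auto simp: proj_eq_iff)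
qed (auto simp: singularities_def)

text \<open>An affine form that vanishes at the midpoint of S_k is odd under the reflection in
  it.\<close>

lemma edge_form_reflect:
  assumes "1 \<le> k" "k \<le> n"
  shows "edge_form k (V k + V (k - 1) - x) = - edge_form k x"
proof -
  have "edge_form k (V (k - 1)) = 0" "edge_form k (V k) = 0"
    using assms by (subst edge_form_vertex_eq_0; force)+
  then show ?thesis by (simp add: edge_form_def algebra_simps)
qed

lemma polygon_Lower_shift: "x - shift n k \<in> polygon n Lower \<longleftrightarrow> V k + V (k - 1) - x \<in> polygon n Upper"
proof -
  have "K - (x - shift n k) = V k + V (k - 1) - x" by (simp add: shift_eq)
  then show ?thesis unfolding polygon_Lower by (simp only:)
qed

text \<open>P_U and the copy of P_L attached along S_k lie on opposite sides of the line of
  S_k.\<close>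

lemma polygons_Int:
  assumes "x \<in> polygon n Upper" "x - shift n k \<in> polygon n Lower" "1 \<le> k" "k \<le> n"
  shows "x \<in> edge n Upper k"
proof -
  have "0 \<le> edge_form k x" using assms by (intro edge_form_nonneg)
  moreover have "0 \<le> edge_form k (V k + V (k - 1) - x)"
    using assms by (intro edge_form_nonneg) (auto simp: polygon_Lower_shift)
  then have "0 \<le> - edge_form k x"
    unfolding edge_form_reflect[OF assms(3,4)] .
  ultimately show ?thesis
    using assms by (intro mem_edge_if_edge_form_0) auto
qed

text \<open>The value is meaningful if some representative, moved by u, stays in its polygon; at
  regular points it is then independent of the representative (\<open>expo_eq\<close>).\<close>

definition expo :: "(sheet \<times> plane) set \<Rightarrow> plane \<Rightarrow> (sheet \<times> plane) set" where
  "expo P u = (SOME Q. \<exists>s w. P = proj n (s, w) \<and> w + u \<in> polygon n s \<and> Q = proj n (s, w + u))"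

text \<open>Representatives on different sheets are glued along some S_k. If both stay in their
  polygons, the moved point lies in two adjacent polygons, hence still on S_k by
  \<open>polygons_Int\<close>, and the same gluing identifies the results.\<close>

lemma expo_eq:
  assumes "w \<notin> vertices n s" "w + u \<in> polygon n s"
  shows "expo (proj n (s, w)) u = proj n (s, w + u)"
  unfolding expo_def
proof (rule some_equality)
  have aux: "proj n (Upper, v + u) = proj n (Lower, v' + u)"
    if vv: "proj n (Upper, v) = proj n (Lower, v')" "v \<notin> vertices n Upper \<or> v' \<notin> vertices n Lower"
      "v + u \<in> polygon n Upper" "v' + u \<in> polygon n Lower" for v v'
  proof -
    obtain k where k: "1 \<le> k" "k \<le> n" "v \<in> edge n Upper k" "v' = v - shift n k"
      using proj_other_sheet[OF vv(1,2)] .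
    then have v': "v' + u = (v + u) - shift n k" by simp
    then have "v + u \<in> edge n Upper k" using vv(3,4) k(1,2) v' by (intro polygons_Int) simp_all
    then show ?thesis unfolding v' using k(1,2) by (intro proj_edge)
  qed
  fix Q assume "\<exists>s' w'. proj n (s, w) = proj n (s', w') \<and> w' + u \<in> polygon n s' \<and> Q = proj n (s', w' + u)"
  then obtain s' w' where *: "proj n (s, w) = proj n (s', w')" "w' + u \<in> polygon n s'" "Q = proj n (s', w' + u)"
    by auto
  show "Q = proj n (s, w + u)"
  proof (cases "s = s'")
    case True
    then show ?thesis using * assms proj_same_sheet by blast
  next
    case False
    then have "s = Upper \<and> s' = Lower \<or> s = Lower \<and> s' = Upper" by (metis sheet.exhaust)
    then show ?thesis using aux[of w w'] aux[of w' w] * assms by auto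
  qed
qed (use assms in auto)

section \<open>Cylinder coordinates\<close>

definition tr :: "nat \<Rightarrow> int \<Rightarrow> plane" where "tr j i = vector [of_int i * circ j, 0]"

lemma tr_nth [simp]: "tr j i $ 1 = of_int i * circ j" "tr j i $ 2 = 0"
  by (simp_all add: tr_def)

lemma tr_add: "tr j i + tr j i' = tr j (i + i')" and tr_diff: "tr j i - tr j i' = tr j (i - i')"
  and tr_0 [simp]: "tr j 0 = 0"
  by (simp_all add: vec2_eq_iff algebra_simps)

text \<open>The zero line of the form ht j * x + \<kappa> j * y is the left leg S_(n-j). The floor
  counts the periods beyond it, so that the base point of a strip point falls into the parallelogram
  made of the two pieces, its right side excluded.\<close>

definition cyl_base :: "nat \<Rightarrow> plane \<Rightarrow> plane" where
  "cyl_base j z = z - tr j \<lfloor>(ht j * z$1 + \<kappa> j * z$2) / (ht j * circ j)\<rfloor>"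

definition cyl :: "nat \<Rightarrow> plane \<Rightarrow> (sheet \<times> plane) set" where
  "cyl j z = (let b = cyl_base j z; s = (if b \<in> piece j Upper then Upper else Lower)
     in proj n (s, b - offset j s))"

lemma vector_eta: "vector [z$1, z$2] = (z :: plane)"
  by (simp add: vec2_eq_iff)

text \<open>The gluings along the two legs differ by one turn of the cylinder, the sum of the two
  bar vectors. This closes up the strip here and also moves the polygon copies of the guide.\<close>

lemma shift_period:
  assumes "j < m"
  shows "shift n (j + 2) = shift n (n - j) + tr j 1"
proof -
  have "j < n" "Suc j < n" using assms n_eq by auto
  then show ?thesis
    using V_left_right[of j] V_left_right[of "Suc j"]
    by (simp add: shift_eq vec2_eq_iff circ_def)
qed

lemma glue_right:
  assumes j: "j < m" and z: "z \<in> piece j Upper" "z \<in> piece j Lower"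
  shows "proj n (Upper, z - offset j Upper) = proj n (Lower, z - offset j Lower)"
proof -
  have "V (n - j) + vector [z$1, z$2] \<in> edge n Upper (j + 2)"
    using z by (intro right_edge_point[OF j]) (auto simp: strip_def)
  then have "proj n (Upper, V (n - j) + z) = proj n (Lower, V (n - j) + z - shift n (j + 2))"
    using j n_eq unfolding vector_eta by (intro proj_edge) auto
  then show ?thesis by (simp add: algebra_simps)
qed

lemma glue_left:
  assumes j: "j < m" and z: "z - tr j 1 \<in> piece j Upper" "z \<in> piece j Lower"
  shows "proj n (Upper, z - tr j 1 - offset j Upper) = proj n (Lower, z - offset j Lower)"
proof -
  define v where "v = z - tr j 1"
  have "V (n - j) + vector [v$1, v$2] \<in> edge n Upper (n - j)"
    using z by (intro left_edge_point[OF j]) (auto simp: strip_def v_def algebra_simps)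
  then have "proj n (Upper, V (n - j) + v) = proj n (Lower, V (n - j) + v - shift n (n - j))"
    using j n_eq unfolding vector_eta by (intro proj_edge) auto
  then show ?thesis using shift_period[OF j] by (simp add: v_def algebra_simps)
qed

lemma piece_bounds:
  assumes j: "j < m" and z: "z \<in> strip j"
  shows "- \<kappa> j * z$2 \<le> ht j * width j + \<kappa> j * z$2"
    "ht j * width j + \<kappa> j * z$2 \<le> ht j * circ j - \<kappa> j * z$2"
proof -
  \<comment> \<open>Scaled by \<open>ht j\<close>, the horizontal section of either piece has a
    width that interpolates linearly between the two bar lengths; these products are the terms of
    the interpolation.\<close>
  have "0 \<le> width j * (ht j - z$2)" "0 \<le> width (Suc j) * z$2"
    "0 \<le> width (Suc j) * (ht j - z$2)" "0 \<le> width j * z$2"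
    using z width_nonneg[of j] width_nonneg[of "Suc j"] j by (auto simp: strip_def)
  then show "- \<kappa> j * z$2 \<le> ht j * width j + \<kappa> j * z$2"
    "ht j * width j + \<kappa> j * z$2 \<le> ht j * circ j - \<kappa> j * z$2"
    by (simp_all add: width_Suc circ_def algebra_simps)
qed

lemma strip_tr [simp]: "z - tr j i \<in> strip k \<longleftrightarrow> z \<in> strip k" "z + tr j i \<in> strip k \<longleftrightarrow> z \<in> strip k"
  by (auto simp: strip_def)

lemma piece_strip: "z \<in> piece j s \<Longrightarrow> z \<in> strip j"
  by (cases s) auto

lemma cyl_base_piece:
  assumes j: "j < m" and z: "z \<in> strip j"
  shows "cyl_base j z \<in> piece j Upper \<union> piece j Lower"
proof -
  define i where "i = \<lfloor>(ht j * z$1 + \<kappa> j * z$2) / (ht j * circ j)\<rfloor>"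
  have "0 < ht j * circ j" using ht_pos circ_pos j by simp
  then have "of_int i * (ht j * circ j) \<le> ht j * z$1 + \<kappa> j * z$2"
    "ht j * z$1 + \<kappa> j * z$2 < (of_int i + 1) * (ht j * circ j)"
    unfolding i_def by (simp_all add: pos_le_divide_eq[symmetric] pos_divide_less_eq[symmetric])
  moreover define v where "v = z - tr j i"
  have "v \<in> strip j" "ht j * z$1 + \<kappa> j * z$2 = ht j * v$1 + \<kappa> j * v$2 + of_int i * (ht j * circ j)"
    using z by (simp_all add: v_def algebra_simps)
  ultimately have "v \<in> strip j" "0 \<le> ht j * v$1 + \<kappa> j * v$2" "ht j * v$1 + \<kappa> j * v$2 < ht j * circ j"
    by (simp_all add: algebra_simps)
  moreover have "cyl_base j z = v" by (simp add: cyl_base_def i_def v_def)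
  ultimately show ?thesis by auto
qed

text \<open>Any period and any sheet may be used to evaluate \<open>cyl\<close>. The floor is i or i
  + 1; two sheets can compete only on a leg, where \<open>glue_right\<close> and
  \<open>glue_left\<close> identify the values.\<close>

lemma cyl_eq:
  assumes j: "j < m" and z: "z - tr j i \<in> piece j s"
  shows "cyl j z = proj n (s, z - tr j i - offset j s)"
proof -
  define v where "v = z - tr j i"
  have zs: "z \<in> strip j" using piece_strip[OF z] by simp
  have vs: "v \<in> strip j" using piece_strip[OF z] by (simp add: v_def)
  define I where "I = \<lfloor>(ht j * z$1 + \<kappa> j * z$2) / (ht j * circ j)\<rfloor>"
  have hc: "0 < ht j * circ j" using ht_pos circ_pos j by simp
  have ht: "0 < ht j" using ht_pos j by simp
  have I: "of_int I * (ht j * circ j) \<le> ht j * z$1 + \<kappa> j * z$2"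
    "ht j * z$1 + \<kappa> j * z$2 < (of_int I + 1) * (ht j * circ j)"
    using hc unfolding I_def by (simp_all add: pos_le_divide_eq[symmetric] pos_divide_less_eq[symmetric])
  have v: "ht j * z$1 + \<kappa> j * z$2 = ht j * v$1 + \<kappa> j * v$2 + of_int i * (ht j * circ j)"
    by (simp add: v_def algebra_simps)
  have bnd: "0 \<le> ht j * v$1 + \<kappa> j * v$2" "ht j * v$1 + \<kappa> j * v$2 \<le> ht j * circ j"
    using piece_bounds[OF j vs] z unfolding v_def[symmetric] by (cases s; auto)+
  have "of_int i * (ht j * circ j) < (of_int I + 1) * (ht j * circ j)"
    "of_int I * (ht j * circ j) \<le> (of_int i + 1) * (ht j * circ j)"
    using I bnd unfolding v by (simp_all add: algebra_simps)
  then have "(of_int i :: real) < of_int I + 1" "(of_int I :: real) \<le> of_int i + 1"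
    using hc by (simp_all only: mult_less_cancel_right_pos mult_le_cancel_right_pos)
  then have "i < I + 1" "I \<le> i + 1" by linarith+
  then consider "I = i" | "I = i + 1" by linarith
  then show ?thesis
  proof cases
    case 1
    then have b: "cyl_base j z = v" by (simp add: cyl_base_def I_def[symmetric] v_def)
    show ?thesis
      using glue_right[OF j, of v] z unfolding cyl_def b Let_def v_def[symmetric]
      by (cases s) (auto simp del: piece.simps offset.simps)
  next
    case 2
    then have b: "cyl_base j z = v - tr j 1"
      by (simp add: cyl_base_def I_def[symmetric] v_def tr_add[symmetric])
    \<comment> \<open>The floor exceeds i only if the bound is attained: the point lies on the
      closing leg, whose translate by one period is the left leg.\<close>
    have "ht j * v$1 + \<kappa> j * v$2 = ht j * circ j"
      using I(1) bnd unfolding v 2 by (simp add: algebra_simps)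
    then have *: "v - tr j 1 \<in> piece j Upper" "v \<in> piece j Lower"
      using piece_bounds[OF j vs] vs by (auto simp: algebra_simps)
    have "cyl j z = proj n (Lower, v - offset j Lower)"
      unfolding cyl_def b Let_def using * glue_left[OF j *] by (simp del: piece.simps offset.simps)
    also have "\<dots> = proj n (s, v - offset j s)"
      using glue_right[OF j, of v] z *(2) unfolding v_def[symmetric]
      by (cases s) (auto simp del: piece.simps offset.simps)
    finally show ?thesis by (simp add: v_def)
  qed
qed

lemma cyl_cover:
  assumes "j < m" "z \<in> strip j"
  obtains i s where "z - tr j i \<in> piece j s"
  using cyl_base_piece[OF assms] unfolding cyl_base_def by blast

lemma cyl_periodic:
  assumes "j < m" "z \<in> strip j"
  shows "cyl j (z + tr j i) = cyl j z"
proof -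
  obtain i' s where z: "z - tr j i' \<in> piece j s" using cyl_cover assms .
  moreover have "z + tr j i - tr j (i + i') = z - tr j i'" by (simp add: tr_add[symmetric])
  ultimately show ?thesis using cyl_eq[OF assms(1)] by metis
qed

lemma cyl_of_trap:
  assumes "j < m" "w \<in> trap j s"
  shows "cyl j (w + offset j s) = proj n (s, w)"
  using cyl_eq[OF assms(1), of "w + offset j s" 0 s] piece_iff[OF assms(1), of "w + offset j s" s] assms
  by simp

lemma level_offset:
  assumes "j < m"
  shows "level s (z - offset j s) = (case s of Upper \<Rightarrow> H j + z$2 | Lower \<Rightarrow> H (Suc j) - z$2)"
proof -
  have "j < n" using assms n_eq by auto
  then show ?thesis
    using V_left_height[of j] by (cases s) (auto simp: shift_eq H_def)
qed

lemma level_vertex: "w \<in> vertices n s \<Longrightarrow> \<exists>i\<le>m. level s w = H i"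
proof -
  have "\<exists>i\<le>m. v$2 = H i" if "v \<in> vertices n Upper" for v
    using that by (rule vertex_height) auto
  from this[of w] this[of "K - w"] show "w \<in> vertices n s \<Longrightarrow> ?thesis"
    by (cases s) (auto simp: vertices_Lower)
qed

text \<open>An edge other than S_1 joins two consecutive levels, so strictly inside a band there are
  only its two legs. By the height sum, the gluing along such a leg takes level y to
  \<open>H j + H (Suc j)\<close> - y and keeps the band.\<close>

lemma edge_level:
  assumes w: "w \<in> edge n Upper k" and k: "1 \<le> k" "k \<le> n" and j: "j < m"
    and l: "H j < w$2" "w$2 < H (Suc j)"
  shows "k = j + 2 \<or> k = n - j" "V k $ 2 + V (k - 1) $ 2 = H j + H (Suc j)"
proof -
  obtain t where t: "w$2 = (1 - t) * V (k - 1) $ 2 + t * V k $ 2" "0 \<le> t" "t \<le> 1"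
    using w by (auto simp: edge_def in_segment)
  have between: "w$2 \<in> closed_segment (V (k - 1) $ 2) (V k $ 2)"
    using t by (auto simp: in_segment)
  have *: "i = j" if "i < m" "V (k - 1) $ 2 = H i \<and> V k $ 2 = H (Suc i) \<or> V (k - 1) $ 2 = H (Suc i) \<and> V k $ 2 = H i" for i
    using that between H_less[of i "Suc i"] H_level_unique[OF l, of i] j
    by (auto simp: closed_segment_eq_real_ivl split: if_splits)
  consider "k = 1" | "2 \<le> k" "k \<le> m + 1" | "m + 1 < k" using k by linarith
  then have "(k = j + 2 \<or> k = n - j) \<and> V k $ 2 + V (k - 1) $ 2 = H j + H (Suc j)"
  proof cases
    case 1
    then have "w$2 = H 0" using t by (simp add: H_0 upper_vertex_def)
    then show ?thesis using H_not_level[of j 0] l j by simp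
  next
    case 2
    define i where "i = k - 2"
    have i: "k = i + 2" "i < m" using 2 by (auto simp: i_def)
    then have v: "V (k - 1) $ 2 = H i" "V k $ 2 = H (Suc i)" by (simp_all add: H_def)
    then have "i = j" using * i by blast
    then show ?thesis using i v by simp
  next
    case 3
    define i where "i = n - k"
    have i: "k = n - i" "i < m" using 3 k n_eq by (auto simp: i_def)
    then have "i < n" "Suc i < n" using n_eq by auto
    then have v: "V (k - 1) $ 2 = H (Suc i)" "V k $ 2 = H i"
      using V_left_height[of i] V_left_height[of "Suc i"] i by simp_all
    then have "i = j" using * i by blast
    then show ?thesis using i v by simp
  qed
  then show "k = j + 2 \<or> k = n - j" "V k $ 2 + V (k - 1) $ 2 = H j + H (Suc j)" by auto
qed

text \<open>Only the first point has to be strictly inside its strip: it is then regular, and a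
  second representative is the same point or its partner across a leg. Injectivity, disjointness of
  the cylinders and well-definedness of the twist all come from here.\<close>

lemma cyl_eq_cyl:
  assumes j: "j < m" "j' < m" and z: "0 < z$2" "z$2 < ht j" and z': "z' \<in> strip j'"
    and eq: "cyl j z = cyl j' z'"
  shows "j = j'" "\<exists>i. z = z' + tr j i"
proof -
  have "z \<in> strip j" using z by (simp add: strip_def)
  then obtain i s where p: "z - tr j i \<in> piece j s" using cyl_cover j by blast
  obtain i' s' where p': "z' - tr j' i' \<in> piece j' s'" using cyl_cover j z' by blast
  define w w' where "w = z - tr j i - offset j s" and "w' = z' - tr j' i' - offset j' s'"
  have eq': "proj n (s, w) = proj n (s', w')"
    using eq cyl_eq[OF j(1) p] cyl_eq[OF j(2) p'] by (simp add: w_def w'_def)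
  have lev: "H j < level s w" "level s w < H (Suc j)"
    using z unfolding w_def level_offset[OF j(1)] by (cases s; simp add: H_Suc)+
  have lev': "H j' \<le> level s' w'" "level s' w' \<le> H (Suc j')"
    using z' unfolding w'_def level_offset[OF j(2)] by (cases s'; simp add: H_Suc strip_def)+
  have nv: "w \<notin> vertices n s"
    using level_vertex[of w s] H_not_level[of j] lev j by force
  have zz: "z = w + tr j i + offset j s" "z' = w' + tr j' i' + offset j' s'"
    by (simp_all add: w_def w'_def)
  have "j = j' \<and> (\<exists>i. z = z' + tr j i)"
  proof (cases "s = s'")
    case True
    then have "w = w'" using eq' nv proj_same_sheet by blast
    then have "j = j'" using H_level_unique[OF lev, of j'] lev' True j by simp
    then have "z = z' + tr j (i - i')"
      unfolding zz using \<open>w = w'\<close> True by (simp add: tr_diff[symmetric])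
    then show ?thesis using \<open>j = j'\<close> by blast
  next
    case False
    then consider "s = Upper" "s' = Lower" | "s = Lower" "s' = Upper" by (metis sheet.exhaust)
    then show ?thesis
    proof cases
      case 1
      obtain k where k: "1 \<le> k" "k \<le> n" "w \<in> edge n Upper k" "w' = w - shift n k"
        using proj_other_sheet[of w w'] eq' nv 1 by blast
      have e: "k = j + 2 \<or> k = n - j" "V k $ 2 + V (k - 1) $ 2 = H j + H (Suc j)"
        using edge_level[OF k(3,1,2) j(1)] lev 1 by auto
      have "level Lower w' = H j + H (Suc j) - w$2"
        unfolding k(4) using e(2) by (simp add: shift_eq)
      then have "j = j'" using H_level_unique[of j "level Lower w'" j'] lev lev' 1 j by simp
      \<comment> \<open>Gluing along the common leg keeps the period index; along the closing leg it
        changes by one (\<open>shift_period\<close>).\<close>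
      have "z = z' + tr j (i - i') \<or> z = z' + tr j (i - i' - 1)"
        unfolding zz k(4) using e(1) shift_period[OF j(1)] \<open>j = j'\<close> 1
        by (auto simp: tr_diff[symmetric])
      then show ?thesis using \<open>j = j'\<close> by blast
    next
      case 2
      obtain k where k: "1 \<le> k" "k \<le> n" "w' \<in> edge n Upper k" "w = w' - shift n k"
        using proj_other_sheet[of w' w] eq' nv 2 by metis
      have "K - w \<in> edge n Upper k"
        using k edge_Lower'[of w] edge_Lower[of w] by simp
      then have e: "k = j + 2 \<or> k = n - j" "V k $ 2 + V (k - 1) $ 2 = H j + H (Suc j)"
        using edge_level[OF _ k(1,2) j(1), of "K - w"] lev 2 by auto
      have w': "w' = w + shift n k" using k by simp
      have "level Upper w' = H j + H (Suc j) - level Lower w"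
        unfolding w' using e(2) by (simp add: shift_eq)
      then have "j = j'" using H_level_unique[of j "level Upper w'" j'] lev lev' 2 j by simp
      have "z = z' + tr j (i - i') \<or> z = z' + tr j (i - i' + 1)"
        unfolding zz w' using e(1) shift_period[OF j(1)] \<open>j = j'\<close> 2
        by (auto simp: tr_diff[symmetric] tr_add[symmetric])
      then show ?thesis using \<open>j = j'\<close> by blast
    qed
  qed
  then show "j = j'" "\<exists>i. z = z' + tr j i" by auto
qed

section \<open>Topology of the cylinders\<close>

lemma topspace_polygons: "topspace (disjoint_polygons n) = Sigma UNIV (polygon n)"
  by (auto simp: disjoint_polygons_def)

lemma proj_topspace: "w \<in> polygon n s \<Longrightarrow> proj n (s, w) \<in> topspace (surface n)"
  by (simp add: topspace_surface topspace_polygons)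

lemma topspaceE:
  assumes "P \<in> topspace (surface n)"
  obtains s w where "P = proj n (s, w)" "w \<in> polygon n s"
  using assms by (auto simp: topspace_surface topspace_polygons)

lemma level_bounds:
  assumes "w \<in> polygon n s"
  shows "0 \<le> level s w" "level s w \<le> H m"
  using assms Upper_height[of w] Upper_height[of "K - w"] by (cases s; simp add: polygon_Lower)+

lemma trap_cover:
  assumes "w \<in> polygon n s"
  obtains j where "j < m" "w \<in> trap j s"
proof (cases "level s w = H m")
  case True
  \<comment> \<open>\<open>level_ex_lower\<close> leaves out the apex height, which belongs to the
    last band.\<close>
  have "m = Suc (m - 1)" using m_pos by simp
  then show thesis
    using True assms H_le[of "m - 1" m] that[of "m - 1"] by (auto simp: trap_def)
next
  case False
  then obtain j where "j < m" "H j \<le> level s w" "level s w < H (Suc j)"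
    using level_bounds[OF assms] level_ex_lower[of "level s w"] by auto
  then show thesis using that assms by (auto simp: trap_def)
qed

lemma trap_strip: "j < m \<Longrightarrow> w \<in> trap j s \<Longrightarrow> w + offset j s \<in> strip j"
  using piece_iff[of j "w + offset j s" s] piece_strip by simp

lemma surface_cover:
  assumes "P \<in> topspace (surface n)"
  obtains j z where "j < m" "z \<in> strip j" "P = cyl j z"
proof -
  obtain s w where w: "P = proj n (s, w)" "w \<in> polygon n s" using assms by (rule topspaceE)
  obtain j where "j < m" "w \<in> trap j s" using w(2) by (rule trap_cover)
  then show thesis using that trap_strip cyl_of_trap w by metis
qed

lemma cyl_rep:
  assumes "j < m" "z \<in> strip j"
  obtains i s where "z - tr j i - offset j s \<in> trap j s" "cyl j z = proj n (s, z - tr j i - offset j s)"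
  using cyl_cover[OF assms] cyl_eq[OF assms(1)] piece_iff[OF assms(1)] by metis

lemma cyl_topspace:
  assumes "j < m" "z \<in> strip j"
  shows "cyl j z \<in> topspace (surface n)"
proof -
  obtain i s where "z - tr j i - offset j s \<in> trap j s" "cyl j z = proj n (s, z - tr j i - offset j s)"
    using assms by (rule cyl_rep)
  then show ?thesis using proj_topspace by (auto simp: trap_def)
qed

lemma strip_closed: "closed (strip j)"
  unfolding strip_def by (intro closed_Collect_conj closed_Collect_le continuous_intros)

lemma piece_closed: "closed (piece j s)"
proof -
  have "piece j Upper = strip j \<inter> {z. - \<kappa> j * z$2 \<le> ht j * z$1} \<inter> {z. ht j * z$1 \<le> ht j * width j + \<kappa> j * z$2}"
    "piece j Lower = strip j \<inter> {z. ht j * width j + \<kappa> j * z$2 \<le> ht j * z$1} \<inter> {z. ht j * z$1 \<le> ht j * circ j - \<kappa> j * z$2}"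
    by auto
  moreover have "closed \<dots>" "closed (strip j \<inter> {z. - \<kappa> j * z$2 \<le> ht j * z$1} \<inter> {z. ht j * z$1 \<le> ht j * width j + \<kappa> j * z$2})"
    by (intro closed_Int strip_closed closed_Collect_le continuous_intros)+
  ultimately show ?thesis by (cases s) (simp_all only:)
qed

lemma piece_index:
  assumes j: "j < m" and z: "z - tr j i \<in> piece j s"
  shows "of_int i * (ht j * circ j) \<le> ht j * z$1 + \<kappa> j * z$2"
    "ht j * z$1 + \<kappa> j * z$2 \<le> (of_int i + 1) * (ht j * circ j)"
  using piece_bounds[OF j piece_strip[OF z]] z by (cases s; simp add: algebra_simps)+

text \<open>On the ball the form ht j * x + \<kappa> j * y is bounded, and by
  \<open>piece_index\<close> it confines the period index.\<close>

lemma pieces_near_finite: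
  assumes j: "j < m"
  shows "finite {(i, s). \<exists>z\<in>ball x 1. z - tr j i \<in> piece j s}"
proof -
  define g where "g z = ht j * z$1 + \<kappa> j * z$2" for z :: plane
  define D where "D = \<bar>ht j\<bar> * (norm x + 1) + \<bar>\<kappa> j\<bar> * (norm x + 1)"
  have hc: "0 < ht j * circ j" using ht_pos circ_pos j by simp
  have g: "\<bar>g z\<bar> \<le> D" if "z \<in> ball x 1" for z
  proof -
    have "norm z \<le> norm x + 1"
      using that norm_triangle_ineq2[of z x] by (simp add: dist_norm norm_minus_commute)
    then have "\<bar>z$1\<bar> \<le> norm x + 1" "\<bar>z$2\<bar> \<le> norm x + 1"
      using component_le_norm_cart[of z 1] component_le_norm_cart[of z 2] by linarith+
    then have "\<bar>ht j * z$1\<bar> \<le> \<bar>ht j\<bar> * (norm x + 1)" "\<bar>\<kappa> j * z$2\<bar> \<le> \<bar>\<kappa> j\<bar> * (norm x + 1)"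
      by (simp_all add: abs_mult mult_left_mono)
    then show ?thesis unfolding g_def D_def by linarith
  qed
  define N where "N = \<lceil>D / (ht j * circ j)\<rceil> + 1"
  have "{(i, s). \<exists>z\<in>ball x 1. z - tr j i \<in> piece j s} \<subseteq> {-N..N} \<times> {Upper, Lower}"
  proof clarify
    fix i s z assume z: "z \<in> ball x 1" "z - tr j i \<in> piece j s"
    have "of_int i * (ht j * circ j) \<le> D" "- D \<le> (of_int i + 1) * (ht j * circ j)"
      using piece_index[OF j z(2)] g[OF z(1)] unfolding g_def by linarith+
    then have "of_int i \<le> D / (ht j * circ j)" "(- D) / (ht j * circ j) \<le> of_int i + 1"
      using hc by (simp_all only: pos_le_divide_eq pos_divide_le_eq)
    moreover define d where "d = D / (ht j * circ j)"
    ultimately have "of_int i \<le> d" "- d \<le> of_int i + 1"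
      by (simp_all only: minus_divide_left)
    then have "i \<le> N" "- N \<le> i" unfolding N_def d_def[symmetric] by linarith+
    then show "i \<in> {-N..N} \<and> s \<in> {Upper, Lower}" by (cases s) auto
  qed
  then show ?thesis by (rule finite_subset) simp
qed

text \<open>Closed and locally finite pieces: a small move enters no piece that did not contain the
  starting point.\<close>

lemma near_pieces:
  assumes j: "j < m"
  shows "\<forall>\<^sub>F u in nhds 0. \<forall>i s. x + u - tr j i \<in> piece j s \<longrightarrow> x - tr j i \<in> piece j s"
proof -
  let ?F = "{(i, s). \<exists>z\<in>ball x 1. z - tr j i \<in> piece j s}"
  have "\<forall>p\<in>?F. \<forall>\<^sub>F u in nhds 0. x + u - tr j (fst p) \<in> piece j (snd p) \<longrightarrow> x - tr j (fst p) \<in> piece j (snd p)"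
  proof
    fix p
    show "\<forall>\<^sub>F u in nhds 0. x + u - tr j (fst p) \<in> piece j (snd p) \<longrightarrow> x - tr j (fst p) \<in> piece j (snd p)"
    proof (cases "x - tr j (fst p) \<in> piece j (snd p)")
      case False
      have "((\<lambda>u. x + u - tr j (fst p)) \<longlongrightarrow> x + 0 - tr j (fst p)) (nhds 0)"
        by (intro tendsto_intros filterlim_ident)
      moreover have "open (- piece j (snd p))" using piece_closed by auto
      ultimately have "\<forall>\<^sub>F u in nhds 0. x + u - tr j (fst p) \<in> - piece j (snd p)"
        using False by (intro topological_tendstoD) auto
      then show ?thesis by eventually_elim auto
    qed simp
  qed
  then have "\<forall>\<^sub>F u in nhds 0. \<forall>p\<in>?F. x + u - tr j (fst p) \<in> piece j (snd p) \<longrightarrow> x - tr j (fst p) \<in> piece j (snd p)"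
    by (intro eventually_ball_finite pieces_near_finite j)
  moreover have "\<forall>\<^sub>F u in nhds (0::plane). dist u 0 < 1"
    unfolding eventually_nhds_metric by (intro exI[of _ 1]) simp
  ultimately show ?thesis
  proof eventually_elim
    case (elim u)
    have b: "x + u \<in> ball x 1" using elim(2) by (simp add: dist_norm)
    show ?case
    proof (intro allI impI)
      fix i s assume u: "x + u - tr j i \<in> piece j s"
      then have "(i, s) \<in> ?F" unfolding mem_Collect_eq prod.case using b by (rule bexI)
      from bspec[OF elim(1) this] u show "x - tr j i \<in> piece j s" by (simp only: fst_conv snd_conv)
    qed
  qed
qed

lemma proj_continuous:
  assumes "continuous_map X (top_of_set (polygon n s)) g"
  shows "continuous_map X (surface n) (\<lambda>x. proj n (s, g x))"
proof -
  have "continuous_map (top_of_set (polygon n s)) (disjoint_polygons n) (\<lambda>w. (s, w))"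
    unfolding disjoint_polygons_def by (rule continuous_map_component_injection) simp
  then have "continuous_map (top_of_set (polygon n s)) (surface n) (proj n \<circ> (\<lambda>w. (s, w)))"
    using quotient_imp_continuous_map[OF quotient_map_proj] by (rule continuous_map_compose)
  then have "continuous_map X (surface n) (proj n \<circ> (\<lambda>w. (s, w)) \<circ> g)"
    by (rule continuous_map_compose[OF assms])
  then show ?thesis by (simp add: o_def)
qed

text \<open>The floor jumps, so the formulas of \<open>cyl_eq\<close> are pasted over the locally
  finite closed cover by translated pieces; they agree on overlaps because each equals
  \<open>cyl j\<close>.\<close>

lemma cyl_continuous:
  assumes j: "j < m"
  shows "continuous_map (top_of_set (strip j)) (surface n) (cyl j)"
proof (rule pasting_lemma_locally_finite[where I = UNIV
      and T = "\<lambda>(i, s). {z \<in> strip j. z - tr j i \<in> piece j s}"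
      and f = "\<lambda>(i, s) z. proj n (s, z - tr j i - offset j s)"])
  fix x assume "x \<in> topspace (top_of_set (strip j))"
  moreover have "finite {i \<in> UNIV. (case i of (i, s) \<Rightarrow> {z \<in> strip j. z - tr j i \<in> piece j s}) \<inter> (strip j \<inter> ball x 1) \<noteq> {}}"
    by (rule finite_subset[OF _ pieces_near_finite[OF j, of x]]) auto
  ultimately show "\<exists>V. openin (top_of_set (strip j)) V \<and> x \<in> V \<and>
      finite {i \<in> UNIV. (case i of (i, s) \<Rightarrow> {z \<in> strip j. z - tr j i \<in> piece j s}) \<inter> V \<noteq> {}}"
    by (intro exI[of _ "strip j \<inter> ball x 1"]) auto
next
  fix p :: "int \<times> sheet"
  obtain i s where p: "p = (i, s)" by (rule prod.exhaust)
  have "closed ((\<lambda>z. z - tr j i) -` piece j s)"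
    by (intro continuous_closed_vimage piece_closed continuous_intros)
  then show "closedin (top_of_set (strip j)) (case p of (i, s) \<Rightarrow> {z \<in> strip j. z - tr j i \<in> piece j s})"
    unfolding p closedin_closed by auto
  have "continuous_map (top_of_set {z \<in> strip j. z - tr j i \<in> piece j s}) (top_of_set (polygon n s))
      (\<lambda>z. z - tr j i - offset j s)"
    using piece_iff[OF j] by (auto simp: continuous_map_in_subtopology trap_def intro!: continuous_intros)
  then have "continuous_map (top_of_set {z \<in> strip j. z - tr j i \<in> piece j s}) (surface n)
      (\<lambda>z. proj n (s, z - tr j i - offset j s))"
    by (rule proj_continuous)
  then show "continuous_map (subtopology (top_of_set (strip j)) (case p of (i, s) \<Rightarrow> {z \<in> strip j. z - tr j i \<in> piece j s}))
      (surface n) (case p of (i, s) \<Rightarrow> \<lambda>z. proj n (s, z - tr j i - offset j s))"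
    unfolding p by (simp add: subtopology_subtopology Int_absorb1 Collect_restrict)
next
  fix p q :: "int \<times> sheet" and x
  assume x: "x \<in> topspace (top_of_set (strip j)) \<inter> (case p of (i, s) \<Rightarrow> {z \<in> strip j. z - tr j i \<in> piece j s}) \<inter>
       (case q of (i, s) \<Rightarrow> {z \<in> strip j. z - tr j i \<in> piece j s})"
  obtain i s where p: "p = (i, s)" by (rule prod.exhaust)
  obtain i' s' where q: "q = (i', s')" by (rule prod.exhaust)
  have "x - tr j i \<in> piece j s" "x - tr j i' \<in> piece j s'"
    using x unfolding p q prod.case by blast+
  note this[THEN cyl_eq[OF j]]
  then show "(case p of (i, s) \<Rightarrow> \<lambda>z. proj n (s, z - tr j i - offset j s)) x =
      (case q of (i, s) \<Rightarrow> \<lambda>z. proj n (s, z - tr j i - offset j s)) x"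
    unfolding p q prod.case by (rule trans[OF sym])
next
  fix x assume "x \<in> topspace (top_of_set (strip j))"
  then have x: "x \<in> strip j" by simp
  obtain i s where z: "x - tr j i \<in> piece j s" using cyl_cover[OF j x] .
  show "\<exists>p. p \<in> UNIV \<and> x \<in> (case p of (i, s) \<Rightarrow> {z \<in> strip j. z - tr j i \<in> piece j s}) \<and>
      cyl j x = (case p of (i, s) \<Rightarrow> \<lambda>z. proj n (s, z - tr j i - offset j s)) x"
    using cyl_eq[OF j z] x z by (intro exI[of _ "(i, s)"] conjI) (simp_all only: prod.case mem_Collect_eq UNIV_I)
qed

section \<open>The twist\<close>

text \<open>The integer e puts the inverse shear into the same family, so that each lemma on the
  twist also serves for its inverse.\<close>

definition shear :: "int \<Rightarrow> plane \<Rightarrow> plane" where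
  "shear e z = z + vector [of_int e * (2 * cot \<alpha> * z$2), 0]"

lemma shear_nth [simp]: "shear e z $ 1 = z$1 + of_int e * (2 * cot \<alpha> * z$2)" "shear e z $ 2 = z$2"
  by (simp_all add: shear_def)

lemma shear_add: "shear e (z + w) = shear e z + shear e w"
  by (simp add: vec2_eq_iff algebra_simps)

lemma shear_tr: "shear e (z + tr j i) = shear e z + tr j i"
  by (simp add: vec2_eq_iff)

lemma shear_strip [simp]: "shear e z \<in> strip j \<longleftrightarrow> z \<in> strip j"
  by (simp add: strip_def)

lemma shear_shear: "shear e (shear (- e) z) = z"
  by (simp add: vec2_eq_iff)

lemma linear_shear: "linear (shear e)"
  by (rule linearI) (simp_all add: vec2_eq_iff algebra_simps)

lemma shear_continuous: "continuous_on S g \<Longrightarrow> continuous_on S (\<lambda>x. shear e (g x))"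
  by (rule continuous_on_compose2[where t = UNIV, OF linear_continuous_on])
    (simp_all add: linear_shear linear_conv_bounded_linear[symmetric])

text \<open>The shear fixes the lower boundary and, by \<open>circ_ht\<close>, translates the upper
  one by e full periods.\<close>

lemma shear_boundary:
  assumes "j < m" "z$2 = 0 \<or> z$2 = ht j"
  shows "cyl j (shear e z) = cyl j z"
proof -
  have "z \<in> strip j" using assms ht_pos[of j] by (auto simp: strip_def)
  moreover have "shear e z = z \<or> shear e z = z + tr j e"
    using assms by (auto simp: vec2_eq_iff circ_ht)
  ultimately show ?thesis using cyl_periodic[OF assms(1)] by metis
qed

definition twist :: "int \<Rightarrow> (sheet \<times> plane) set \<Rightarrow> (sheet \<times> plane) set" where
  "twist e P = (SOME Q. \<exists>j z. j < m \<and> z \<in> strip j \<and> P = cyl j z \<and> Q = cyl j (shear e z))"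

text \<open>If one of two representatives is strictly inside its strip, they differ by a period,
  which commutes with the shear. Otherwise both are on boundaries, possibly of different cylinders,
  and both shears fix the point.\<close>

lemma twist_cyl:
  assumes j: "j < m" and z: "z \<in> strip j"
  shows "twist e (cyl j z) = cyl j (shear e z)"
  unfolding twist_def
proof (rule some_equality)
  fix Q assume "\<exists>j' z'. j' < m \<and> z' \<in> strip j' \<and> cyl j z = cyl j' z' \<and> Q = cyl j' (shear e z')"
  then obtain j' z' where *: "j' < m" "z' \<in> strip j'" "cyl j z = cyl j' z'" "Q = cyl j' (shear e z')"
    by auto
  have aux: "j = j' \<and> (\<exists>i. z = z' + tr j i)"
    if "0 < z$2 \<and> z$2 < ht j \<or> 0 < z'$2 \<and> z'$2 < ht j'"
    using that
  proof
    assume "0 < z$2 \<and> z$2 < ht j"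
    then show ?thesis using cyl_eq_cyl[OF j *(1) _ _ *(2,3)] by blast
  next
    assume "0 < z'$2 \<and> z'$2 < ht j'"
    then have "j' = j" "\<exists>i. z' = z + tr j i"
      using cyl_eq_cyl[OF *(1) j _ _ z *(3)[symmetric]] by auto
    then obtain i where "z' = z + tr j i" by auto
    then have "z = z' + tr j (- i)" by (simp add: vec2_eq_iff)
    then show ?thesis using \<open>j' = j\<close> by blast
  qed
  show "Q = cyl j (shear e z)"
  proof (cases "0 < z$2 \<and> z$2 < ht j \<or> 0 < z'$2 \<and> z'$2 < ht j'")
    case True
    then obtain i where "j = j'" "z = z' + tr j i" using aux by auto
    then show ?thesis using * shear_tr cyl_periodic[OF j, of "shear e z'"] by simp
  next
    case False
    then have "z$2 = 0 \<or> z$2 = ht j" "z'$2 = 0 \<or> z'$2 = ht j'"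
      using z *(2) by (auto simp: strip_def)
    then show ?thesis using shear_boundary j * by metis
  qed
qed (use assms in auto)

lemma twist_twist:
  assumes "P \<in> topspace (surface n)"
  shows "twist e (twist (- e) P) = P"
proof -
  obtain j z where "j < m" "z \<in> strip j" "P = cyl j z" using assms by (rule surface_cover)
  then show ?thesis by (simp add: twist_cyl shear_shear)
qed

lemma level_continuous: "continuous_on S (level s)"
proof -
  have "level s = (case s of Upper \<Rightarrow> (\<lambda>z. z$2) | Lower \<Rightarrow> (\<lambda>z. K$2 - z$2))"
    by (cases s) auto
  then show ?thesis by (cases s) (auto intro!: continuous_intros)
qed

lemma trap_closed: "closed (trap j s)"
proof -
  have "trap j s = polygon n s \<inter> {z. H j \<le> level s z} \<inter> {z. level s z \<le> H (Suc j)}"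
    by (auto simp: trap_def)
  then show ?thesis
    by (auto intro!: closed_Int polygon_closed closed_Collect_le level_continuous continuous_intros)
qed

lemma snd_continuous: "continuous_map (disjoint_polygons n) euclidean snd"
  unfolding continuous_map_def topspace_polygons
proof (intro conjI allI impI)
  fix U :: "plane set" assume "openin euclidean U"
  then show "openin (disjoint_polygons n) {x \<in> Sigma UNIV (polygon n). snd x \<in> U}"
    by (auto simp: disjoint_polygons_def openin_sum_topology Collect_conj_eq intro: openin_open_Int)
qed simp

text \<open>Continuity is checked before gluing, on the finitely many closed trapezoids of the two
  polygons, where the twist is a translation followed by \<open>shear\<close> and
  \<open>cyl\<close>; it then descends through the quotient map.\<close>

lemma twist_continuous: "continuous_map (surface n) (surface n) (twist e)"
proof -
  have "continuous_map (disjoint_polygons n) (surface n) (twist e \<circ> proj n)"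
  proof (rule pasting_lemma_closed[where I = "{..<m} \<times> {Upper, Lower}" and T = "\<lambda>(j, s). {s} \<times> trap j s"
        and f = "\<lambda>(j, s) p. cyl j (shear e (snd p + offset j s))"])
    fix p assume "p \<in> {..<m} \<times> {Upper, Lower}"
    then obtain j s where p: "p = (j, s)" "j < m" by auto
    have "closedin (top_of_set (polygon n t)) {w. (t, w) \<in> {s} \<times> trap j s}" for t
      using trap_closed by (cases "t = s") (auto simp: trap_def intro: closed_subset)
    then have c: "closedin (disjoint_polygons n) ({s} \<times> trap j s)"
      by (auto simp: disjoint_polygons_def closedin_sum_topology trap_def)
    then show "closedin (disjoint_polygons n) (case p of (j, s) \<Rightarrow> {s} \<times> trap j s)"
      by (simp add: p)
    have "continuous_map euclidean euclidean (\<lambda>w. shear e (w + offset j s))"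
      unfolding continuous_map_iff_continuous2 by (intro shear_continuous continuous_intros)
    from continuous_map_compose[OF snd_continuous this]
    have "continuous_map (disjoint_polygons n) euclidean (\<lambda>q. shear e (snd q + offset j s))"
      by (simp add: o_def)
    then have "continuous_map (subtopology (disjoint_polygons n) ({s} \<times> trap j s)) (top_of_set (strip j))
        (\<lambda>q. shear e (snd q + offset j s))"
      using trap_strip[OF p(2)]
      by (auto simp: continuous_map_in_subtopology continuous_map_from_subtopology)
    then have "continuous_map (subtopology (disjoint_polygons n) ({s} \<times> trap j s)) (surface n)
        (cyl j \<circ> (\<lambda>q. shear e (snd q + offset j s)))"
      by (rule continuous_map_compose[OF _ cyl_continuous[OF p(2)]])
    then show "continuous_map (subtopology (disjoint_polygons n) (case p of (j, s) \<Rightarrow> {s} \<times> trap j s)) (surface n)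
        (case p of (j, s) \<Rightarrow> \<lambda>q. cyl j (shear e (snd q + offset j s)))"
      by (simp add: p o_def)
  next
    have *: "twist e (proj n (s, w)) = cyl j (shear e (w + offset j s))" if "j < m" "w \<in> trap j s" for j s w
      using twist_cyl[OF that(1) trap_strip[OF that]] cyl_of_trap[OF that] by simp
    show "(case p of (j, s) \<Rightarrow> \<lambda>q. cyl j (shear e (snd q + offset j s))) x =
        (case q of (j, s) \<Rightarrow> \<lambda>q. cyl j (shear e (snd q + offset j s))) x"
      if pqx: "p \<in> {..<m} \<times> {Upper, Lower}" "q \<in> {..<m} \<times> {Upper, Lower}"
        "x \<in> topspace (disjoint_polygons n) \<inter> (case p of (j, s) \<Rightarrow> {s} \<times> trap j s) \<inter> (case q of (j, s) \<Rightarrow> {s} \<times> trap j s)"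
      for p q x
    proof -
      obtain j j' s w where "p = (j, s)" "q = (j', s)" "x = (s, w)"
        using pqx by (cases p; cases q; cases x) auto
      then show ?thesis using pqx *[of j w s] *[of j' w s] by simp
    qed
    show "\<exists>p. p \<in> {..<m} \<times> {Upper, Lower} \<and> x \<in> (case p of (j, s) \<Rightarrow> {s} \<times> trap j s) \<and>
        (twist e \<circ> proj n) x = (case p of (j, s) \<Rightarrow> \<lambda>q. cyl j (shear e (snd q + offset j s))) x"
      if xt: "x \<in> topspace (disjoint_polygons n)" for x
    proof -
      obtain s w where x: "x = (s, w)" "w \<in> polygon n s" using xt by (auto simp: topspace_polygons)
      obtain j where "j < m" "w \<in> trap j s" using x(2) by (rule trap_cover)
      then show ?thesis using *[of j w s] x(1) by (intro exI[of _ "(j, s)"]) (cases s; simp)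
    qed
  qed simp
  then show ?thesis by (rule continuous_compose_quotient_map[OF quotient_map_proj])
qed

lemma twist_homeomorphic: "homeomorphic_map (surface n) (surface n) (twist 1)"
proof -
  have "homeomorphic_maps (surface n) (surface n) (twist 1) (twist (- 1))"
    unfolding homeomorphic_maps_def
    using twist_continuous twist_twist[of _ 1] twist_twist[of _ "- 1"] by simp
  then show ?thesis by (rule homeomorphic_maps_map[THEN iffD1, THEN conjunct1])
qed

section \<open>Horizontal cylinders\<close>

definition open_cyl :: "nat \<Rightarrow> (sheet \<times> plane) set set" where
  "open_cyl j = cyl j ` {z. 0 < z$2 \<and> z$2 < ht j}"

text \<open>Membership becomes a condition on the level, a continuous function on each polygon.
  Openness of the cylinders and the description of the cuts follow from this.\<close>

lemma proj_open_cyl_iff: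
  assumes j: "j < m" and w: "w \<in> polygon n s"
  shows "proj n (s, w) \<in> open_cyl j \<longleftrightarrow> H j < level s w \<and> level s w < H (Suc j)"
proof
  assume "proj n (s, w) \<in> open_cyl j"
  then obtain z where z: "0 < z$2" "z$2 < ht j" "cyl j z = proj n (s, w)"
    by (auto simp: open_cyl_def)
  obtain j' where j': "j' < m" "w \<in> trap j' s" using w by (rule trap_cover)
  then have eq: "cyl j z = cyl j' (w + offset j' s)" using z cyl_of_trap by simp
  note * = cyl_eq_cyl[OF j j'(1) z(1,2) trap_strip[OF j'] eq]
  then obtain i where "z = w + offset j s + tr j i" by auto
  then have "z$2 = (w + offset j s)$2" by simp
  then show "H j < level s w \<and> level s w < H (Suc j)"
    using z level_offset[OF j, of s "w + offset j s"] by (cases s) (auto simp: H_Suc)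
next
  assume l: "H j < level s w \<and> level s w < H (Suc j)"
  then have t: "w \<in> trap j s" using w by (simp add: trap_def)
  have "0 < (w + offset j s)$2 \<and> (w + offset j s)$2 < ht j"
    using l level_offset[OF j, of s "w + offset j s"] by (cases s) (auto simp: H_Suc)
  then show "proj n (s, w) \<in> open_cyl j"
    unfolding open_cyl_def cyl_of_trap[OF j t, symmetric] by blast
qed

lemma open_cyl_subset: "j < m \<Longrightarrow> open_cyl j \<subseteq> topspace (surface n)"
  using cyl_topspace by (auto simp: open_cyl_def strip_def)

lemma openin_open_cyl:
  assumes j: "j < m"
  shows "openin (surface n) (open_cyl j)"
proof -
  have "{w. (s, w) \<in> {p \<in> topspace (disjoint_polygons n). proj n p \<in> open_cyl j}}
      = polygon n s \<inter> ({w. H j < level s w} \<inter> {w. level s w < H (Suc j)})" for s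
    using proj_open_cyl_iff[OF j] by (auto simp: topspace_polygons)
  moreover have "open ({w. H j < level s w} \<inter> {w. level s w < H (Suc j)})" for s
    by (intro open_Int open_Collect_less level_continuous continuous_intros)
  ultimately have "openin (disjoint_polygons n) {p \<in> topspace (disjoint_polygons n). proj n p \<in> open_cyl j}"
    by (subst disjoint_polygons_def) (auto simp: openin_sum_topology topspace_polygons intro: openin_open_Int)
  then show ?thesis
    using open_cyl_subset[OF j] by (simp add: openin_surface topspace_surface)
qed

lemma open_cyl_disjoint:
  assumes "j < m" "j' < m" "P \<in> open_cyl j" "P \<in> open_cyl j'"
  shows "j = j'"
proof -
  obtain z z' where "0 < z$2" "z$2 < ht j" "0 < z'$2" "z'$2 < ht j'" "cyl j z = cyl j' z'"
    using assms(3,4) by (auto simp: open_cyl_def)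
  then show ?thesis using cyl_eq_cyl(1)[OF assms(1,2), of z z'] by (simp add: strip_def)
qed

text \<open>The last trapezoid is a triangle: as \<open>width m\<close> is 0, the two leg
  inequalities meet at the top height.\<close>

lemma Upper_top:
  assumes "w \<in> polygon n Upper" "w$2 = H m"
  shows "w = V (Suc m)"
proof -
  define j where "j = m - 1"
  have j: "m = Suc j" "j < m" "j < n" "Suc j < n" using m_pos n_eq by (auto simp: j_def)
  have "w \<in> trap j Upper" using assms H_le[of j m] j by (simp add: trap_def)
  then have p: "w - V (n - j) \<in> piece j Upper" using piece_iff[OF j(2), of "w - V (n - j)" Upper] by simp
  have y: "(w - V (n - j))$2 = ht j" using assms V_left_height[OF j(3)] j(1) by (simp add: H_Suc)
  have w0: "width j + 2 * \<kappa> j = 0" using width_m j(1) by (simp add: width_Suc)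
  have "ht j * (w - V (n - j))$1 = - \<kappa> j * ht j"
  proof (rule antisym)
    have "width j = - 2 * \<kappa> j" using w0 by simp
    then have "ht j * width j + \<kappa> j * ht j = - \<kappa> j * ht j" by (simp add: algebra_simps)
    then show "ht j * (w - V (n - j))$1 \<le> - \<kappa> j * ht j" using p y by (simp del: vector_minus_component)
    show "- \<kappa> j * ht j \<le> ht j * (w - V (n - j))$1" using p y by (simp del: vector_minus_component)
  qed
  then have "ht j * (w - V (n - j))$1 = ht j * - \<kappa> j" by (simp only: mult.commute)
  then have "(w - V (n - j))$1 = - \<kappa> j" using ht_pos[OF j(2)] by (simp only: mult_cancel_left) simp
  then have "w = V (n - j) + vector [- \<kappa> j, ht j]" using y by (simp add: vec2_eq_iff)
  also have "\<dots> = V (n - m)" using V_left[OF j(3)] j(1) by simp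
  also have "n - m = Suc m" using n_eq by simp
  finally show ?thesis .
qed

lemma Upper_level_segment:
  assumes w: "w \<in> polygon n Upper" and i: "i \<le> m" "w$2 = H i"
  shows "w \<in> closed_segment (V (n - i)) (V (Suc i))"
proof (cases "i = m")
  case True
  then show ?thesis using Upper_top w i by auto
next
  case False
  then have j: "i < m" "i < n" using i n_eq by auto
  have "w \<in> trap i Upper" using w i H_le[of i "Suc i"] j by (simp add: trap_def)
  then have "w - V (n - i) \<in> piece i Upper" using piece_iff[OF j(1), of "w - V (n - i)" Upper] by simp
  then have "0 \<le> ht i * (w$1 - V (n - i)$1)" "ht i * (w$1 - V (n - i)$1) \<le> ht i * width i"
    using V_left_height[OF j(2)] i by simp_all
  then have "V (n - i)$1 \<le> w$1" "w$1 \<le> V (n - i)$1 + width i"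
    using ht_pos[OF j(1)] by (simp_all add: zero_le_mult_iff)
  then show ?thesis
    using V_left_height[OF j(2)] i V_left_right[OF j(2)]
    by (subst closed_segment_horizontal) (auto simp: closed_segment_eq_real_ivl)
qed

text \<open>Both sides say that the level is some \<open>H i\<close>: a horizontal segment between
  vertices has the level of a vertex, and the section of a polygon at level \<open>H i\<close> is
  the bar itself.\<close>

lemma cut_iff:
  assumes w: "w \<in> polygon n s"
  shows "proj n (s, w) \<in> horizontal_cuts n \<longleftrightarrow> (\<forall>j<m. proj n (s, w) \<notin> open_cyl j)"
proof
  assume "proj n (s, w) \<in> horizontal_cuts n"
  then obtain t v a b where v: "proj n (s, w) = proj n (t, v)" "a \<in> vertices n t" "b \<in> vertices n t"
    "a$2 = b$2" "v \<in> closed_segment a b"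
    by (auto simp: horizontal_cuts_def)
  have "v \<in> polygon n t"
    using v vertices_subset closed_segment_subset[OF _ _ polygon_convex] by blast
  moreover have "v$2 = a$2" using v closed_segment_horizontal by blast
  then have "level t v = level t a" by (cases t) auto
  then obtain i where "i \<le> m" "level t v = H i" using level_vertex v(2) by metis
  ultimately show "\<forall>j<m. proj n (s, w) \<notin> open_cyl j"
    unfolding v(1) using proj_open_cyl_iff H_not_level by metis
next
  assume *: "\<forall>j<m. proj n (s, w) \<notin> open_cyl j"
  obtain j where j: "j < m" "w \<in> trap j s" using w by (rule trap_cover)
  then have "level s w = H j \<or> level s w = H (Suc j)"
    using * proj_open_cyl_iff[OF j(1) w] by (auto simp: trap_def)
  then obtain i where i: "i \<le> m" "level s w = H i" using j(1) by (metis Suc_leI less_imp_le)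
  have i': "n - i \<le> n" "Suc i \<le> n" "i < n" using i(1) n_eq by auto
  have eq2: "vertex n s (n - i) $ 2 = vertex n s (Suc i) $ 2"
    using V_left_right[OF i'(3)] by (cases s) (simp_all add: half_turn_eq)
  have "w \<in> closed_segment (vertex n s (n - i)) (vertex n s (Suc i))"
  proof (cases s)
    case Upper
    then show ?thesis using Upper_level_segment[OF _ i(1), of w] w i(2) by simp
  next
    case Lower
    then have "K - w \<in> closed_segment (V (n - i)) (V (Suc i))"
      using Upper_level_segment[OF _ i(1), of "K - w"] w i(2) by (simp add: polygon_Lower)
    then obtain u where u: "K - w = (1 - u) *\<^sub>R V (n - i) + u *\<^sub>R V (Suc i)" "0 \<le> u" "u \<le> 1"
      unfolding in_segment by blast
    have "w = K - (K - w)" by simp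
    also have "\<dots> = (1 - u) *\<^sub>R (K - V (n - i)) + u *\<^sub>R (K - V (Suc i))"
      unfolding u(1) by (simp add: algebra_simps)
    finally show ?thesis
      unfolding in_segment Lower vertex_Lower using u(2,3) by blast
  qed
  then show "proj n (s, w) \<in> horizontal_cuts n"
    unfolding horizontal_cuts_def using eq2 vertex_in_vertices[OF i'(1), of s] vertex_in_vertices[OF i'(2), of s]
    by blast
qed

lemma complement_cuts: "topspace (surface n) - horizontal_cuts n = (\<Union>j<m. open_cyl j)"
proof
  show "topspace (surface n) - horizontal_cuts n \<subseteq> (\<Union>j<m. open_cyl j)"
    using cut_iff by (auto elim!: topspaceE)
  show "(\<Union>j<m. open_cyl j) \<subseteq> topspace (surface n) - horizontal_cuts n"
  proof
    fix P assume "P \<in> (\<Union>j<m. open_cyl j)"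
    then obtain j where j: "j < m" "P \<in> open_cyl j" by auto
    then have P: "P \<in> topspace (surface n)" using open_cyl_subset by auto
    then obtain s w where "P = proj n (s, w)" "w \<in> polygon n s" by (rule topspaceE)
    then show "P \<in> topspace (surface n) - horizontal_cuts n" using cut_iff j P by auto
  qed
qed

text \<open>The open cylinders are connected, open and disjoint and cover the complement of the
  cuts. Each is therefore clopen there, and a component that meets it coincides with it.\<close>

lemma horizontal_cylinder_cases:
  assumes "C \<in> horizontal_cylinders n"
  obtains j where "j < m" "C = open_cyl j"
proof -
  define Y where "Y = subtopology (surface n) (\<Union>j<m. open_cyl j)"
  have C: "C \<in> connected_components_of Y"
    using assms by (simp add: horizontal_cylinders_def complement_cuts Y_def)
  have top: "topspace Y = (\<Union>j<m. open_cyl j)"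
    using open_cyl_subset by (auto simp: Y_def)
  have op: "openin Y (open_cyl j)" if "j < m" for j
    unfolding Y_def using openin_open_cyl[OF that] that
    by (subst openin_subtopology) (auto intro!: exI[of _ "open_cyl j"])
  note nonempty_connected_components_of[OF C] connected_components_of_subset[OF C]
  moreover have CY: "connectedin Y C" by (rule connectedin_connected_components_of[OF C])
  ultimately obtain P j where P: "P \<in> C" "j < m" "P \<in> open_cyl j" using top by blast
  have "connectedin Y (open_cyl j)"
  proof -
    have "convex ((\<lambda>z::plane. z$2) -` {0<..<ht j})"
      by (intro convex_linear_vimage bounded_linear.linear[OF bounded_linear_vec_nth]) simp
    then have "connected {z::plane. 0 < z$2 \<and> z$2 < ht j}"
      by (simp add: convex_connected vimage_def)
    then have "connectedin (top_of_set (strip j)) {z. 0 < z$2 \<and> z$2 < ht j}"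
      by (auto simp: connectedin_subtopology strip_def)
    then have "connectedin (surface n) (open_cyl j)"
      unfolding open_cyl_def by (rule connectedin_continuous_map_image[OF cyl_continuous[OF P(2)]])
    then show ?thesis using P(2) by (auto simp: Y_def connectedin_subtopology)
  qed
  then have 1: "open_cyl j \<subseteq> C"
    using connected_components_of_maximal[OF C] P by (auto simp: disjnt_def)
  have "topspace Y - open_cyl j = (\<Union>k\<in>{..<m} - {j}. open_cyl k)"
    using open_cyl_disjoint P(2) top by blast
  moreover have "openin Y (\<Union>k\<in>{..<m} - {j}. open_cyl k)" using op by auto
  ultimately have "closedin Y (open_cyl j)" using openin_subset[OF op[OF P(2)]] by (simp add: closedin_def)
  then have "C \<subseteq> open_cyl j"
    using connectedin_clopen_cases[OF CY _ op[OF P(2)]] P by (auto simp: disjnt_def)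
  then show thesis using that[of j] 1 P by auto
qed

lemma twist_open_cyl:
  assumes "j < m"
  shows "twist e ` open_cyl j = open_cyl j"
proof -
  have sub: "twist e ` open_cyl j \<subseteq> open_cyl j" for e
  proof
    fix Q assume "Q \<in> twist e ` open_cyl j"
    then obtain z where "0 < z$2" "z$2 < ht j" "Q = twist e (cyl j z)" by (auto simp: open_cyl_def)
    then show "Q \<in> open_cyl j"
      unfolding open_cyl_def using twist_cyl[OF assms, of z e] by (auto simp: strip_def intro!: imageI)
  qed
  have "open_cyl j \<subseteq> twist e ` open_cyl j"
  proof
    fix P assume P: "P \<in> open_cyl j"
    then have "P = twist e (twist (- e) P)" "twist (- e) P \<in> open_cyl j"
      using twist_twist open_cyl_subset[OF assms] sub[of "- e"] by auto
    then show "P \<in> twist e ` open_cyl j" by (rule image_eqI)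
  qed
  with sub show ?thesis by auto
qed

lemma twist_fixes:
  assumes "P \<in> topspace (surface n)" "\<And>j. j < m \<Longrightarrow> P \<notin> open_cyl j"
  shows "twist e P = P"
proof -
  obtain j z where *: "j < m" "z \<in> strip j" "P = cyl j z" using assms(1) by (rule surface_cover)
  then have "z$2 = 0 \<or> z$2 = ht j" using assms(2)[OF *(1)] by (auto simp: open_cyl_def strip_def)
  then show ?thesis using shear_boundary twist_cyl * by simp
qed

text \<open>A frontier point lies in no open cylinder: not in its own, which is open, and not in
  another one, which would be a neighbourhood disjoint from the first.\<close>

lemma twist_frontier:
  assumes j: "j < m" and P: "P \<in> surface n frontier_of open_cyl j"
  shows "twist e P = P"
proof (rule twist_fixes)
  show "P \<in> topspace (surface n)" using P frontier_of_subset_topspace by (rule subsetD[rotated])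
  have cl: "P \<in> surface n closure_of open_cyl j" "P \<notin> open_cyl j"
    using P openin_open_cyl[OF j] by (auto simp: frontier_of_def interior_of_openin)
  fix j' assume j': "j' < m"
  show "P \<notin> open_cyl j'"
  proof
    assume "P \<in> open_cyl j'"
    then obtain Q where "Q \<in> open_cyl j" "Q \<in> open_cyl j'"
      using cl openin_open_cyl[OF j'] by (auto simp: in_closure_of)
    then have "j = j'" using open_cyl_disjoint j j' by blast
    then show False using cl \<open>P \<in> open_cyl j'\<close> by simp
  qed
qed

lemma twist_singular:
  assumes "P \<in> singularities n"
  shows "twist e P = P"
proof -
  obtain s w where w: "P = proj n (s, w)" "w \<in> vertices n s" using assms by (auto simp: singularities_def)
  then have wp: "w \<in> polygon n s" using vertices_subset by auto
  obtain i where "i \<le> m" "level s w = H i" using level_vertex[OF w(2)] by auto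
  then show ?thesis
    using proj_topspace[OF wp] proj_open_cyl_iff[OF _ wp] H_not_level unfolding w(1)
    by (intro twist_fixes) auto
qed

section \<open>Local coordinates\<close>

text \<open>By \<open>near_pieces\<close> the piece used at z + u already contains z, so one polygon
  and one translation give both values. The premise on z + u keeps the statement valid for z on the
  boundary of the strip.\<close>

lemma cyl_expo:
  assumes j: "j < m" and z: "z \<in> strip j" and reg: "cyl j z \<notin> singularities n"
  shows "\<forall>\<^sub>F u in nhds 0. z + u \<in> strip j \<longrightarrow> cyl j (z + u) = expo (cyl j z) u"
  using near_pieces[OF j, of z]
proof eventually_elim
  case (elim u)
  show ?case
  proof
    assume "z + u \<in> strip j"
    then obtain i s where 1: "z + u - tr j i \<in> piece j s" using cyl_cover[OF j] by blast
    then have 0: "z - tr j i \<in> piece j s" using elim by simp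
    define w where "w = z - tr j i - offset j s"
    have w: "z + u - tr j i - offset j s = w + u" by (simp add: w_def)
    have "w + u \<in> polygon n s"
      using 1 piece_iff[OF j, of "z + u - tr j i" s] unfolding w by (simp add: trap_def)
    moreover have cz: "cyl j z = proj n (s, w)" using cyl_eq[OF j 0] by (simp add: w_def)
    moreover have "w \<notin> vertices n s" using reg singular_iff cz by simp
    moreover have "cyl j (z + u) = proj n (s, w + u)" using cyl_eq[OF j 1] unfolding w .
    ultimately show "cyl j (z + u) = expo (cyl j z) u" using expo_eq by simp
  qed
qed

lemma level_less_top:
  assumes "w \<in> polygon n s" "w \<notin> vertices n s"
  shows "level s w < H m"
proof -
  have "V (Suc m) \<in> vertices n Upper" using vertex_in_vertices[of "Suc m" Upper] n_eq m_pos by simp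
  then have "level s w \<noteq> H m"
    using assms Upper_top[of w] Upper_top[of "K - w"]
    by (cases s) (auto simp: polygon_Lower vertices_Lower)
  then show ?thesis using level_bounds(2)[OF assms(1)] by simp
qed

text \<open>A point of S_1 lies on both boundaries of the bottom cylinder: on the lower one through
  P_U, on the upper one through P_L.\<close>

lemma level_0:
  assumes "w \<in> polygon n s" "level s w = 0"
  obtains v v' where "v \<in> polygon n Upper" "level Upper v = 0" "proj n (s, w) = proj n (Upper, v)"
    "v' \<in> polygon n Lower" "level Lower v' = 0" "proj n (s, w) = proj n (Lower, v')"
proof -
  have bottom: "v \<in> edge n Upper 1" if "v \<in> polygon n Upper" "v$2 = 0" for v
    using that n_ge_3 by (intro mem_edge_if_edge_form_0) (auto simp: edge_form_def)
  have V1: "V 1 $ 2 = 0" using H_0 by (simp add: H_def)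
  show thesis
  proof (cases s)
    case Upper
    then have e: "w \<in> edge n Upper 1" using bottom assms by simp
    then have "w - shift n 1 \<in> edge n Lower 1" by (simp add: edge_Lower)
    then have "w - shift n 1 \<in> polygon n Lower" using edge_subset_polygon[of 1] n_ge_3 by auto
    moreover have "level Lower (w - shift n 1) = 0"
      using assms Upper V1 by (simp add: shift_eq)
    ultimately show thesis using that assms Upper proj_edge[OF e] n_ge_3 by auto
  next
    case Lower
    then have "K - w \<in> edge n Upper 1" using bottom[of "K - w"] assms by (simp add: polygon_Lower)
    then have e: "w + shift n 1 \<in> edge n Upper 1" using edge_Lower edge_Lower' by simp
    then have "w + shift n 1 \<in> polygon n Upper" using edge_subset_polygon[of 1] n_ge_3 by auto
    moreover have "level Upper (w + shift n 1) = 0"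
      using assms Lower V1 by (simp add: shift_eq)
    ultimately show thesis using that assms Lower proj_edge[OF e] n_ge_3 by auto
  qed
qed

lemma trap_height:
  assumes "j < m" "w \<in> trap j s"
  shows "(w + offset j s)$2 = (case s of Upper \<Rightarrow> level s w - H j | Lower \<Rightarrow> H (Suc j) - level s w)"
  using level_offset[OF assms(1), of s "w + offset j s"] by (cases s) simp_all

text \<open>
  The upper half-disc around a regular point lies in the first cylinder, the lower one in the second;
  so points on the cuts need no separate treatment.
\<close>

lemma regular_point_cases:
  assumes "P \<in> topspace (surface n)" "P \<notin> singularities n"
  shows "\<exists>j z. j < m \<and> P = cyl j z \<and> 0 \<le> z$2 \<and> z$2 < ht j"
    and "\<exists>j z. j < m \<and> P = cyl j z \<and> 0 < z$2 \<and> z$2 \<le> ht j"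
proof -
  obtain s w where w: "P = proj n (s, w)" "w \<in> polygon n s" using assms(1) by (rule topspaceE)
  have top: "level s w < H m" using w assms(2) singular_iff level_less_top by simp
  have *: "(\<exists>j z. j < m \<and> P = cyl j z \<and> 0 \<le> z$2 \<and> z$2 < ht j) \<and>
      (\<exists>j z. j < m \<and> P = cyl j z \<and> 0 < z$2 \<and> z$2 \<le> ht j)"
  proof (cases "level s w = 0")
    case True
    obtain v v' where v: "v \<in> polygon n Upper" "level Upper v = 0" "P = proj n (Upper, v)"
      "v' \<in> polygon n Lower" "level Lower v' = 0" "P = proj n (Lower, v')"
      using level_0[OF w(2) True] w(1) by metis
    have m0: "0 < m" using m_pos by simp
    then have t: "v \<in> trap 0 Upper" "v' \<in> trap 0 Lower"
      using v ht_pos[of 0] by (auto simp: trap_def H_0 H_Suc)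
    have h: "(v + offset 0 Upper)$2 = 0" "(v' + offset 0 Lower)$2 = ht 0"
      using trap_height[OF m0 t(1)] trap_height[OF m0 t(2)] v(2,5) by (simp_all only: H_0 H_Suc sheet.case)
    have c: "P = cyl 0 (v + offset 0 Upper)" "P = cyl 0 (v' + offset 0 Lower)"
      using cyl_of_trap[OF m0 t(1)] cyl_of_trap[OF m0 t(2)] v(3,6) by (simp_all only:)
    have "0 \<le> (v + offset 0 Upper)$2" "(v + offset 0 Upper)$2 < ht 0"
      "0 < (v' + offset 0 Lower)$2" "(v' + offset 0 Lower)$2 \<le> ht 0"
      using ht_pos[OF m0] unfolding h by simp_all
    then show ?thesis using c m0 by blast
  next
    case False
    then have pos: "0 < level s w" using level_bounds(1)[OF w(2)] by simp
    obtain j where j: "j < m" "H j \<le> level s w" "level s w < H (Suc j)"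
      using level_ex_lower[of "level s w"] pos top by auto
    obtain j' where j': "j' < m" "H j' < level s w" "level s w \<le> H (Suc j')"
      using level_ex_upper[of "level s w"] pos top by auto
    have t: "w \<in> trap j s" "w \<in> trap j' s" using j j' w by (auto simp: trap_def)
    have c: "P = cyl j (w + offset j s)" "P = cyl j' (w + offset j' s)"
      using cyl_of_trap j j' t w by simp_all
    show ?thesis
    proof (cases s)
      case Upper
      then have "0 \<le> (w + offset j s)$2" "(w + offset j s)$2 < ht j"
        "0 < (w + offset j' s)$2" "(w + offset j' s)$2 \<le> ht j'"
        using trap_height[OF j(1) t(1)] trap_height[OF j'(1) t(2)] j j' by (simp_all add: H_Suc)
      then show ?thesis using c j j' by blast
    next
      case Lower
      then have "0 < (w + offset j s)$2" "(w + offset j s)$2 \<le> ht j"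
        "0 \<le> (w + offset j' s)$2" "(w + offset j' s)$2 < ht j'"
        using trap_height[OF j(1) t(1)] trap_height[OF j'(1) t(2)] j j' by (simp_all add: H_Suc)
      then show ?thesis using c j j' by blast
    qed
  qed
  then show "\<exists>j z. j < m \<and> P = cyl j z \<and> 0 \<le> z$2 \<and> z$2 < ht j"
    "\<exists>j z. j < m \<and> P = cyl j z \<and> 0 < z$2 \<and> z$2 \<le> ht j" by auto
qed

text \<open>The half-turn about the midpoint of S_k. It exchanges P_U with the attached copy of P_L,
  so that facts about the copy follow from those about P_U.\<close>

definition reflect :: "nat \<Rightarrow> plane \<Rightarrow> plane" where
  "reflect k z = V k + V (k - 1) - z"

lemma reflect_reflect [simp]: "reflect k (reflect k z) = z"
  by (simp add: reflect_def)

lemma polygon_Lower_reflect: "z - shift n k \<in> polygon n Lower \<longleftrightarrow> reflect k z \<in> polygon n Upper"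
  by (simp only: polygon_Lower_shift reflect_def)

lemma patch_eq: "patch n k = interior {z. z \<in> polygon n Upper \<or> reflect k z \<in> polygon n Upper}"
proof -
  have "z \<in> (\<lambda>w. w + shift n k) ` polygon n Lower \<longleftrightarrow> reflect k z \<in> polygon n Upper" for z
    unfolding polygon_Lower_reflect[symmetric] by (auto simp: image_iff intro: bexI[of _ "z - shift n k"])
  then have "polygon n Upper \<union> (\<lambda>w. w + shift n k) ` polygon n Lower
      = {z. z \<in> polygon n Upper \<or> reflect k z \<in> polygon n Upper}"
    by blast
  then show ?thesis by (simp only: patch_def)
qed

lemma patch_subset: "z \<in> patch n k \<Longrightarrow> z \<in> polygon n Upper \<or> reflect k z \<in> polygon n Upper"
  unfolding patch_eq using interior_subset by blast

lemma open_patch: "open (patch n k)"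
  by (simp add: patch_def)

lemma patch_reflect:
  assumes "z \<in> patch n k"
  shows "reflect k z \<in> patch n k"
proof -
  obtain e where e: "0 < e" "ball z e \<subseteq> {z. z \<in> polygon n Upper \<or> reflect k z \<in> polygon n Upper}"
    using assms unfolding patch_eq mem_interior by auto
  have "y \<in> {z. z \<in> polygon n Upper \<or> reflect k z \<in> polygon n Upper}" if "y \<in> ball (reflect k z) e" for y
  proof -
    have "reflect k z - y = reflect k y - z" by (simp add: reflect_def)
    then have "reflect k y \<in> ball z e" using that by (simp add: dist_norm norm_minus_commute)
    then show ?thesis using e(2) by auto
  qed
  then show ?thesis unfolding patch_eq mem_interior using e(1) by blast
qed

text \<open>The angle 2 d \<alpha> would be pi only for 2 d = n, which is impossible for odd n;
  beyond pi the argument is reduced by pi.\<close>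

lemma sin_double_nonzero:
  assumes "0 < d" "d < n"
  shows "sin (2 * (real d * \<alpha>)) \<noteq> 0"
proof (cases "2 * d < n")
  case True
  then show ?thesis using sin_pos[of "2 * d"] assms by (simp add: algebra_simps)
next
  case False
  moreover have "2 * d \<noteq> n" using odd_n by auto
  ultimately have "0 < 2 * d - n" "2 * d - n < n" "n \<le> 2 * d" using assms by auto
  moreover have "2 * (real d * \<alpha>) = real (2 * d - n) * \<alpha> + pi"
    using \<open>n \<le> 2 * d\<close> n_alpha by (simp add: of_nat_diff algebra_simps)
  ultimately show ?thesis using sin_pos[of "2 * d - n"] by (simp del: of_nat_diff)
qed

text \<open>
  Moving along the direction of edge \<open>k\<close>, which for odd \<open>n\<close> is parallel to no other edge, leaves the
  two glued polygons immediately from a point on the line of another edge \<open>l\<close>.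
\<close>

lemma patch_off_edges:
  assumes k: "1 \<le> k" "k \<le> n" and l: "1 \<le> l" "l \<le> n" "l \<noteq> k"
    and z: "z \<in> patch n k" "z \<in> polygon n Upper"
  shows "edge_form l z \<noteq> 0"
proof
  assume l0: "edge_form l z = 0"
  define \<theta> \<theta>' where "\<theta> = 2 * (real k * \<alpha> - \<alpha>)" and "\<theta>' = 2 * (real l * \<alpha> - \<alpha>)"
  define d :: plane where "d = vector [cos \<theta>, sin \<theta>]"
  define \<sigma> where "\<sigma> = sin (\<theta> - \<theta>')"
  have "\<sigma> \<noteq> 0"
  proof (cases "l < k")
    case True
    then have "\<theta> - \<theta>' = 2 * (real (k - l) * \<alpha>)" by (simp add: \<theta>_def \<theta>'_def of_nat_diff algebra_simps)
    moreover have "0 < k - l" "k - l < n" using True k l by auto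
    ultimately show ?thesis using sin_double_nonzero unfolding \<sigma>_def by metis
  next
    case False
    then have "\<theta> - \<theta>' = - (2 * (real (l - k) * \<alpha>))" using l(3) by (simp add: \<theta>_def \<theta>'_def of_nat_diff algebra_simps)
    moreover have "0 < l - k" "l - k < n" using False k l by auto
    ultimately show ?thesis using sin_double_nonzero unfolding \<sigma>_def by (metis sin_minus neg_equal_0_iff_equal)
  qed
  have ek: "edge_form k (z + t *\<^sub>R d) = edge_form k z" for t
    unfolding edge_form_def d_def \<theta>_def[symmetric] by (simp add: algebra_simps)
  have el: "edge_form l (z + t *\<^sub>R d) = t * \<sigma>" for t
    using l0 unfolding edge_form_def d_def \<theta>'_def[symmetric] \<sigma>_def sin_diff
    by (simp add: algebra_simps)
  have "norm d = 1"
    by (simp add: d_def norm_eq_sqrt_inner inner_vec_def sum_2 power2_eq_square[symmetric])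
  obtain e where e: "0 < e" "ball z e \<subseteq> {z. z \<in> polygon n Upper \<or> reflect k z \<in> polygon n Upper}"
    using z(1) unfolding patch_eq mem_interior by auto
  \<comment> \<open>The sign makes the form of S_l negative, the factor e / 2 keeps the point in the
    ball.\<close>
  define t where "t = - sgn \<sigma> * (e / 2)"
  define q where "q = z + t *\<^sub>R d"
  have "q \<in> ball z e"
    using e(1) \<open>norm d = 1\<close> \<open>\<sigma> \<noteq> 0\<close> by (simp add: q_def t_def dist_norm abs_mult abs_sgn_eq)
  moreover have "t * \<sigma> = - (\<bar>\<sigma>\<bar> * (e / 2))" by (simp add: t_def abs_sgn)
  then have "edge_form l q < 0" using el[of t] \<open>\<sigma> \<noteq> 0\<close> e(1) by (simp add: q_def)
  then have qU: "q \<notin> polygon n Upper" using edge_form_nonneg[OF _ l(1,2), of q] by auto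
  ultimately have R: "reflect k q \<in> polygon n Upper" using e(2) by auto
  \<comment> \<open>Moving along S_k keeps its form and the reflection negates it. Both P_U points
    have a nonnegative form, so it is 0 and q lies on S_k, inside P_U after all.\<close>
  have "edge_form k (reflect k q) = - edge_form k z"
    unfolding reflect_def edge_form_reflect[OF k] by (simp add: q_def ek)
  moreover have "0 \<le> edge_form k (reflect k q)" "0 \<le> edge_form k z"
    using edge_form_nonneg[OF _ k] R z by auto
  ultimately have "edge_form k (reflect k q) = 0" by simp
  then have "reflect k q \<in> edge n Upper k" using R k by (intro mem_edge_if_edge_form_0)
  then have "q \<in> edge n Upper k"
    using edge_point_reflection[of q k] by (simp add: reflect_def add.commute)
  then show False using qU edge_subset_polygon k by blast
qed

lemma patch_regular:
  assumes k: "1 \<le> k" "k \<le> n" and z: "z \<in> patch n k"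
  shows "z \<notin> vertices n Upper" "z - shift n k \<notin> vertices n Lower"
proof -
  have *: "z \<notin> vertices n Upper" if z: "z \<in> patch n k" for z
  proof
    assume zv: "z \<in> vertices n Upper"
    then obtain i where i: "i < n" "z = V i" by (auto simp: vertices_def)
    have zU: "z \<in> polygon n Upper" using zv vertices_subset by auto
    \<comment> \<open>The two edges that meet at the vertex; at least one of them is not
      S_k.\<close>
    define l l' where "l = (if i = 0 then 1 else i)" and "l' = (if i = 0 then n else i + 1)"
    have l: "1 \<le> l" "l \<le> n" "1 \<le> l'" "l' \<le> n" "l \<noteq> l'" using i n_ge_3 by (auto simp: l_def l'_def)
    have "edge_form l z = 0" "edge_form l' z = 0"
      using i l by (simp_all add: edge_form_vertex_eq_0 l_def l'_def)
    then show False
      using patch_off_edges[OF k l(1,2) _ z zU] patch_off_edges[OF k l(3,4) _ z zU] l(5) by auto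
  qed
  show "z \<notin> vertices n Upper" using *[OF z] .
  have "K - (z - shift n k) = reflect k z" by (simp add: reflect_def shift_eq)
  then show "z - shift n k \<notin> vertices n Lower"
    using *[OF patch_reflect[OF z]] unfolding vertices_Lower by (simp only: not_False_eq_True)
qed

lemma patch_map_eq:
  assumes k: "1 \<le> k" "k \<le> n"
  shows "z \<in> polygon n Upper \<Longrightarrow> patch_map n k z = proj n (Upper, z)"
    "z - shift n k \<in> polygon n Lower \<Longrightarrow> patch_map n k z = proj n (Lower, z - shift n k)"
  using polygons_Int[OF _ _ k] proj_edge[OF _ k] by (auto simp: patch_map_def)

lemma patch_cases:
  assumes "z \<in> patch n k"
  obtains "z \<in> polygon n Upper" | "z - shift n k \<in> polygon n Lower"
  using patch_subset[OF assms] polygon_Lower_reflect by blast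

lemma patch_map_regular:
  assumes k: "1 \<le> k" "k \<le> n" and z: "z \<in> patch n k"
  shows "patch_map n k z \<in> topspace (surface n)" "patch_map n k z \<notin> singularities n"
  using patch_cases[OF z] patch_map_eq[OF k] patch_regular[OF k z] proj_topspace singular_iff by metis+

text \<open>Only points on different sheets need an argument: they are glued along some S_l, and
  \<open>patch_off_edges\<close> forces l = k, where the translations agree.\<close>

lemma patch_map_inj:
  assumes k: "1 \<le> k" "k \<le> n"
  shows "inj_on (patch_map n k) (patch n k)"
proof (rule inj_onI)
  have mixed: "z = z'" if z: "z \<in> patch n k" "z \<in> polygon n Upper" and "z' \<in> patch n k"
    and eq: "proj n (Upper, z) = proj n (Lower, z' - shift n k)" for z z'
  proof -
    obtain l where l: "1 \<le> l" "l \<le> n" "z \<in> edge n Upper l" "z' - shift n k = z - shift n l"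
      using proj_other_sheet[OF eq] patch_regular(1)[OF k z(1)] by metis
    then have "l = k"
      using patch_off_edges[OF k l(1,2) _ z] edge_form_edge[OF l(1,2,3)] by auto
    then show ?thesis using l(4) by simp
  qed
  fix z z' assume z: "z \<in> patch n k" "z' \<in> patch n k" and eq: "patch_map n k z = patch_map n k z'"
  note reg = patch_regular[OF k z(1)] patch_regular[OF k z(2)]
  show "z = z'"
    using z(1)
  proof (cases rule: patch_cases)
    case 1
    note z1 = 1
    show ?thesis using z(2)
    proof (cases rule: patch_cases)
      case 1
      then show ?thesis using z1 eq patch_map_eq(1)[OF k] proj_same_sheet reg(1) by simp
    next
      case 2
      then show ?thesis using z1 eq patch_map_eq[OF k] mixed[OF z(1) z1 z(2)] by simp
    qed
  next
    case 2
    note z1 = 2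
    show ?thesis using z(2)
    proof (cases rule: patch_cases)
      case 1
      then show ?thesis using z1 eq patch_map_eq[OF k] mixed[OF z(2) 1 z(1)] by simp
    next
      case 2
      then have "z - shift n k = z' - shift n k"
        using z1 eq patch_map_eq(2)[OF k] proj_same_sheet reg(2) by simp
      then show ?thesis by simp
    qed
  qed
qed

section \<open>Derivatives in charts\<close>

lemma tendsto_plus_nhds_0: "((\<lambda>u. z + u) \<longlongrightarrow> (z::plane)) (nhds 0)"
proof -
  have "((\<lambda>u. z + u) \<longlongrightarrow> z + 0) (nhds 0)" by (intro tendsto_intros filterlim_ident)
  then show ?thesis by simp
qed

lemma eventually_mem_closed:
  assumes "closed S"
  shows "\<forall>\<^sub>F u in nhds 0. (z::plane) + u \<in> S \<longrightarrow> z \<in> S"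
proof (cases "z \<in> S")
  case False
  then have "\<forall>\<^sub>F u in nhds 0. z + u \<in> - S"
    using assms by (intro topological_tendstoD[OF tendsto_plus_nhds_0]) auto
  then show ?thesis by eventually_elim auto
qed simp

text \<open>For small u, a closed polygon containing the moved point also contains the starting
  point, so one polygon represents both.\<close>

lemma patch_expo:
  assumes k: "1 \<le> k" "k \<le> n" and z: "z \<in> patch n k"
  shows "\<forall>\<^sub>F u in nhds 0. patch_map n k (z + u) = expo (patch_map n k z) u"
  using topological_tendstoD[OF tendsto_plus_nhds_0 open_patch z]
    eventually_mem_closed[OF polygon_closed[of Upper], of z]
    eventually_mem_closed[OF polygon_closed[of Lower], of "z - shift n k"]
proof eventually_elim
  case (elim u)
  have u: "z + u - shift n k = z - shift n k + u" by simp
  show ?case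
    using elim(1)
  proof (cases rule: patch_cases)
    case 1
    then show ?thesis
      using elim(2) patch_map_eq(1)[OF k] patch_regular(1)[OF k z] expo_eq by simp
  next
    case 2
    then have 0: "z - shift n k \<in> polygon n Lower" using elim(3) u by simp
    have "patch_map n k (z + u) = proj n (Lower, z - shift n k + u)"
      using patch_map_eq(2)[OF k 2] u by simp
    then show ?thesis
      using 2 unfolding u patch_map_eq(2)[OF k 0]
      using patch_regular(2)[OF k z] expo_eq by simp
  qed
qed

lemma chart_derivative:
  fixes A :: "plane \<Rightarrow> plane" and g :: "plane \<Rightarrow> 'p"
  assumes A: "linear A" and D: "open D" "inj_on \<rho> D" "z' \<in> D"
    and g: "\<forall>\<^sub>F u in nhds 0. g (z + u) = \<rho> (z' + A u)"
  shows "((inv_into D \<rho> \<circ> g) has_derivative A) (at z)"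
proof -
  have bl: "bounded_linear A" using A by (simp add: linear_conv_bounded_linear)
  have "((\<lambda>u. z' + A u) \<longlongrightarrow> z' + A 0) (nhds 0)"
    by (intro tendsto_intros bounded_linear.tendsto[OF bl] filterlim_ident)
  then have "((\<lambda>u. z' + A u) \<longlongrightarrow> z') (nhds 0)" by (simp add: linear_0[OF A])
  then have "\<forall>\<^sub>F u in nhds 0. z' + A u \<in> D" by (rule topological_tendstoD[OF _ D(1,3)])
  with g have ev: "\<forall>\<^sub>F u in nhds 0. (inv_into D \<rho> \<circ> g) (z + u) = z' + A u"
    by eventually_elim (simp add: inv_into_f_f[OF D(2)])
  have "((\<lambda>x. x - z) \<longlongrightarrow> z - z) (nhds z)" by (intro tendsto_intros filterlim_ident)
  then have "filterlim (\<lambda>x. x - z) (nhds 0) (nhds z)" by simp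
  from eventually_compose_filterlim[OF ev this]
  have ev': "\<forall>\<^sub>F x in nhds z. (inv_into D \<rho> \<circ> g) x = z' + A (x - z)" by simp
  have "((\<lambda>x. z' + A (x - z)) has_derivative (\<lambda>x. 0 + A (x - 0))) (at z)"
    by (intro derivative_intros has_derivative_compose[OF _ bounded_linear_imp_has_derivative[OF bl]])
  then have der: "((\<lambda>x. z' + A (x - z)) has_derivative A) (at z)" by simp
  have "\<forall>\<^sub>F x in at z. z' + A (x - z) = (inv_into D \<rho> \<circ> g) x"
    using ev' unfolding eventually_at_filter by eventually_elim simp
  moreover have "z' + A (z - z) = (inv_into D \<rho> \<circ> g) z"
    using eventually_nhds_x_imp_x[OF ev'] by simp
  ultimately show ?thesis
    using has_derivative_transform_eventually[OF der] by blast
qed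

lemma atlasE:
  assumes "(D, \<rho>) \<in> atlas n"
  obtains k where "1 \<le> k" "k \<le> n" "D = patch n k" "\<rho> = patch_map n k"
  using assms by (auto simp: atlas_def)

text \<open>The interface to both derivative conditions: charts commute with \<open>expo\<close>, so
  an identity in terms of \<open>expo\<close> makes g affine in the chart near z.\<close>

lemma chart_expo_derivative:
  fixes A :: "plane \<Rightarrow> plane"
  assumes A: "linear A" and k: "1 \<le> k" "k \<le> n" and P: "P \<in> patch_map n k ` patch n k"
    and g: "\<forall>\<^sub>F u in nhds 0. g (z + u) = expo P (A u)"
  shows "((inv_into (patch n k) (patch_map n k) \<circ> g) has_derivative A) (at z)"
proof -
  obtain z' where z': "z' \<in> patch n k" "P = patch_map n k z'" using P by auto
  have bl: "bounded_linear A" using A by (simp add: linear_conv_bounded_linear)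
  have "(A \<longlongrightarrow> A 0) (nhds 0)" by (intro bounded_linear.tendsto[OF bl] filterlim_ident)
  then have "filterlim A (nhds 0) (nhds 0)" by (simp add: linear_0[OF A])
  from eventually_compose_filterlim[OF patch_expo[OF k z'(1)] this]
  have "\<forall>\<^sub>F u in nhds 0. g (z + u) = patch_map n k (z' + A u)"
    using g unfolding z'(2) by eventually_elim simp
  then show ?thesis by (rule chart_derivative[OF A open_patch patch_map_inj[OF k] z'(1)])
qed

lemma twist_expo:
  assumes P: "P \<in> topspace (surface n)" "P \<notin> singularities n" "twist e P \<notin> singularities n"
  shows "\<forall>\<^sub>F u in nhds 0. twist e (expo P u) = expo (twist e P) (shear e u)"
proof -
  have half: "\<forall>\<^sub>F u in nhds 0. z + u \<in> strip j \<longrightarrow> twist e (expo P u) = expo (twist e P) (shear e u)"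
    if j: "j < m" and z: "z \<in> strip j" and Pz: "P = cyl j z" for j z
  proof -
    have tP: "twist e P = cyl j (shear e z)" using twist_cyl[OF j z] Pz by simp
    have "(shear e \<longlongrightarrow> shear e 0) (nhds 0)"
      using bounded_linear.tendsto[OF _ filterlim_ident] linear_shear linear_conv_bounded_linear by blast
    then have "filterlim (shear e) (nhds 0) (nhds 0)" by (simp add: linear_0[OF linear_shear])
    from eventually_compose_filterlim[OF cyl_expo[OF j, of "shear e z"] this]
    have "\<forall>\<^sub>F u in nhds 0. shear e z + shear e u \<in> strip j \<longrightarrow>
        cyl j (shear e z + shear e u) = expo (cyl j (shear e z)) (shear e u)"
      using z P(3) tP by simp
    with cyl_expo[OF j z] P(2)
    have "\<forall>\<^sub>F u in nhds 0. (z + u \<in> strip j \<longrightarrow> cyl j (z + u) = expo (cyl j z) u) \<and>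
       (shear e z + shear e u \<in> strip j \<longrightarrow>
        cyl j (shear e z + shear e u) = expo (cyl j (shear e z)) (shear e u))"
      using Pz by (simp add: eventually_conj)
    then show ?thesis
    proof eventually_elim
      case (elim u)
      then show ?case
        using twist_cyl[OF j, of "z + u" e] tP Pz shear_strip[of e "z + u" j] by (simp add: shear_add)
    qed
  qed
  have height: "\<forall>\<^sub>F u in nhds 0. (z + u :: plane)$2 \<in> S" if "open S" "z$2 \<in> S" for z S
  proof (rule topological_tendstoD[OF _ that])
    show "((\<lambda>u. (z + u)$2) \<longlongrightarrow> z$2) (nhds 0)"
      by (rule tendsto_vec_nth[OF tendsto_plus_nhds_0])
  qed
  obtain j z where z: "j < m" "P = cyl j z" "0 \<le> z$2" "z$2 < ht j"
    using regular_point_cases(1)[OF P(1,2)] by blast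
  obtain j' z' where z': "j' < m" "P = cyl j' z'" "0 < z'$2" "z'$2 \<le> ht j'"
    using regular_point_cases(2)[OF P(1,2)] by blast
  have zs: "z \<in> strip j" "z' \<in> strip j'" using z z' by (auto simp: strip_def)
  have "\<forall>\<^sub>F u in nhds 0. (z + u)$2 \<in> {..<ht j}" "\<forall>\<^sub>F u in nhds 0. (z' + u)$2 \<in> {0<..}"
    using height[of "{..<ht j}" z] height[of "{0<..}" z'] z z' by simp_all
  then show ?thesis
    using half[OF z(1) zs(1) z(2)] half[OF z'(1) zs(2) z'(2)]
  proof eventually_elim
    case (elim u)
    \<comment> \<open>The point \<open>z\<close> has room above it and \<open>z'\<close> has room
      below it, so the sign of \<open>u$2\<close> selects a usable strip.\<close>
    have "z + u \<in> strip j \<or> z' + u \<in> strip j'"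
      using elim(1,2) z z' by (cases "0 \<le> u$2") (auto simp: strip_def)
    then show ?case using elim(3,4) by blast
  qed
qed

lemma shear_matrix_eq: "shear_matrix n *v x = shear 1 x"
  by (simp add: vec2_eq_iff shear_matrix_def matrix_vector_mult_def sum_2 \<alpha>_def)

lemma twist_affine: "affine_automorphism (surface n) (singularities n) (atlas n) (twist 1) (shear_matrix n)"
  unfolding affine_automorphism_def
proof (intro conjI ballI, safe)
  show "homeomorphic_map (surface n) (surface n) (twist 1)" by (rule twist_homeomorphic)
  show "\<And>P. P \<in> singularities n \<Longrightarrow> twist 1 P \<in> singularities n" by (simp add: twist_singular)
  show "\<And>P. P \<in> singularities n \<Longrightarrow> P \<in> twist 1 ` singularities n"
    by (metis twist_singular image_eqI)
  fix D \<rho> D' \<rho>' z v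
  assume charts: "(D, \<rho>) \<in> atlas n" "(D', \<rho>') \<in> atlas n" and z: "z \<in> D" and v: "twist 1 (\<rho> z) = \<rho>' v" "v \<in> D'"
  obtain k where k: "1 \<le> k" "k \<le> n" "D = patch n k" "\<rho> = patch_map n k" using charts(1) by (rule atlasE)
  obtain k' where k': "1 \<le> k'" "k' \<le> n" "D' = patch n k'" "\<rho>' = patch_map n k'" using charts(2) by (rule atlasE)
  have zp: "z \<in> patch n k" using z k by simp
  note P = patch_map_regular[OF k(1,2) zp]
  have P': "twist 1 (patch_map n k z) \<in> patch_map n k' ` patch n k'" using v k k' by auto
  then have "twist 1 (patch_map n k z) \<notin> singularities n" using patch_map_regular(2)[OF k'(1,2)] by auto
  then have "\<forall>\<^sub>F u in nhds 0. twist 1 (expo (patch_map n k z) u) = expo (twist 1 (patch_map n k z)) (shear 1 u)"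
    using twist_expo P by blast
  with patch_expo[OF k(1,2) zp]
  have "\<forall>\<^sub>F u in nhds 0. (twist 1 \<circ> patch_map n k) (z + u) = expo (twist 1 (patch_map n k z)) (shear 1 u)"
    by eventually_elim simp
  then have "((inv_into (patch n k') (patch_map n k') \<circ> (twist 1 \<circ> patch_map n k)) has_derivative shear 1) (at z)"
    by (rule chart_expo_derivative[OF linear_shear k'(1,2) P'])
  then show "((inv_into D' \<rho>' \<circ> twist 1 \<circ> \<rho>) has_derivative (*v) (shear_matrix n)) (at z)"
    by (simp add: k k' shear_matrix_eq[abs_def] o_assoc)
qed

lemma cyl_flat:
  assumes j: "j < m"
  shows "flat_cylinder (surface n) (atlas n) (open_cyl j) (circ j) (ht j) (cyl j)"
  unfolding flat_cylinder_def
proof (intro conjI allI impI ballI)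
  show "continuous_map (top_of_set {z. 0 \<le> z $ 2 \<and> z $ 2 \<le> ht j}) (surface n) (cyl j)"
    using cyl_continuous[OF j] by (simp add: strip_def)
  show "cyl j (z + vector [circ j, 0]) = cyl j z" if "0 \<le> z$2 \<and> z$2 \<le> ht j" for z
    using cyl_periodic[OF j, of z 1] that unfolding strip_def tr_def of_int_1 mult_1 by blast
  show "cyl j ` {z. 0 < z$2 \<and> z$2 < ht j} = open_cyl j" by (simp add: open_cyl_def)
  show "\<exists>i::int. z = w + vector [of_int i * circ j, 0]"
    if "0 < z$2 \<and> z$2 < ht j \<and> 0 < w$2 \<and> w$2 < ht j \<and> cyl j z = cyl j w" for z w
  proof -
    have "w \<in> strip j" using that by (simp add: strip_def)
    then show ?thesis using cyl_eq_cyl(2)[OF j j, of z w] that unfolding tr_def by blast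
  qed
  fix C assume "C \<in> atlas n"
  then obtain k where k: "1 \<le> k" "k \<le> n" "C = (patch n k, patch_map n k)" by (auto simp: atlas_def)
  have "((inv_into (patch n k) (patch_map n k) \<circ> cyl j) has_derivative (\<lambda>x. x)) (at z)"
    if z: "0 < z$2" "z$2 < ht j" "cyl j z \<in> patch_map n k ` patch n k" for z
  proof (rule chart_expo_derivative[OF _ k(1,2) z(3)])
    have "z \<in> strip j" using z by (simp add: strip_def)
    moreover have "cyl j z \<notin> singularities n" using z(3) patch_map_regular(2)[OF k(1,2)] by auto
    ultimately have ev: "\<forall>\<^sub>F u in nhds 0. z + u \<in> strip j \<longrightarrow> cyl j (z + u) = expo (cyl j z) u"
      by (rule cyl_expo[OF j])
    have "((\<lambda>u. (z + u)$2) \<longlongrightarrow> z$2) (nhds 0)"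
      by (rule tendsto_vec_nth[OF tendsto_plus_nhds_0])
    then have "\<forall>\<^sub>F u in nhds 0. (z + u)$2 \<in> {0<..<ht j}"
      by (rule topological_tendstoD) (use z in auto)
    with ev show "\<forall>\<^sub>F u in nhds 0. cyl j (z + u) = expo (cyl j z) u"
      by eventually_elim (simp add: strip_def)
  qed (simp add: linear_id[unfolded id_def])
  then show "case C of (D, \<rho>) \<Rightarrow> \<forall>z. 0 < z$2 \<and> z$2 < ht j \<and> cyl j z \<in> \<rho> ` D \<longrightarrow>
      ((inv_into D \<rho> \<circ> cyl j) has_derivative (\<lambda>x. x)) (at z)"
    unfolding k(3) prod.case by blast
qed (rule circ_pos[OF j], rule ht_pos[OF j])

lemma twist_dehn:
  assumes j: "j < m"
  shows "single_dehn_twist (circ j) (ht j) (cyl j) (twist 1)"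
proof -
  have "circ j * z$2 / ht j = 2 * cot \<alpha> * z$2" for z :: plane
    using ht_pos[OF j] by (simp add: circ_ht)
  then have "z + vector [circ j * z$2 / ht j, 0] = shear 1 z" for z
    by (simp only: shear_def of_int_1 mult_1)
  then show ?thesis
    unfolding single_dehn_twist_def using twist_cyl[OF j] by (simp only: strip_def mem_Collect_eq) blast
qed

section \<open>The vertex generator guide\<close>

text \<open>Each step of the guide adds one circumference (\<open>shift_period\<close>); by
  \<open>circ_ht\<close> these add up to the slope times the height of the bar.\<close>

lemma upper_guide_eq: "j \<le> m \<Longrightarrow> upper_guide n j = vector [2 * cot \<alpha> * H j, 0]"
proof (induction j)
  case 0
  show ?case by (simp add: vec2_eq_iff H_0)
next
  case (Suc j)
  have k: "n + 2 - (j + 2) = n - j" by simp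
  have "upper_guide n (Suc j) = upper_guide n j + shift n (j + 2) - shift n (n - j)"
    unfolding upper_guide.simps Let_def attach_upper_def attach_lower_def k ..
  also have "\<dots> = upper_guide n j + tr j 1"
    using shift_period[of j] Suc.prems by simp
  also have "\<dots> = vector [2 * cot \<alpha> * H j, 0] + tr j 1"
    using Suc by simp
  also have "\<dots> = vector [2 * cot \<alpha> * H (Suc j), 0]"
    by (simp add: vec2_eq_iff H_Suc circ_ht distrib_left)
  finally show ?case .
qed

text \<open>\<open>H 1 - H j\<close> is the height of the bar of P_L at level j. The displacement
  vanishes at j = 1, where the copy is P_L itself, and is one circumference to the right at j =
  0.\<close>

lemma lower_guide_eq:
  assumes "j \<le> m"
  shows "lower_guide n j = vector [2 * cot \<alpha> * (H 1 - H j), 0]"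
proof (cases j)
  case 0
  \<comment> \<open>P_L already touches P_U along S_n, so \<open>shift n n\<close> is 0 and only the
    period remains.\<close>
  have "shift n (0 + 2) = tr 0 1"
    using shift_period[of 0] m_pos by (simp add: shift_eq)
  then have "lower_guide n 0 = tr 0 1" by (simp add: attach_lower_def numeral_2_eq_2)
  then show ?thesis
    using 0 by (simp add: vec2_eq_iff H_0 H_Suc circ_ht)
next
  case (Suc i)
  have "lower_guide n (Suc i) = vector [2 * cot \<alpha> * (H 1 - H (Suc i)), 0]" if "Suc i \<le> m" for i
    using that
  proof (induction i)
    case 0
    show ?case by (simp add: vec2_eq_iff)
  next
    case (Suc i)
    have k: "i + 3 = Suc i + 2" "n + 2 - (Suc i + 2) = n - Suc i" by simp_all
    have "lower_guide n (Suc (Suc i)) = lower_guide n (Suc i) - shift n (Suc i + 2) + shift n (n - Suc i)"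
      unfolding lower_guide.simps Let_def attach_upper_def attach_lower_def k(1) k(2) ..
    also have "\<dots> = lower_guide n (Suc i) - tr (Suc i) 1"
      using shift_period[of "Suc i"] Suc.prems by simp
    also have "\<dots> = vector [2 * cot \<alpha> * (H 1 - H (Suc i)), 0] - tr (Suc i) 1"
      using Suc by simp
    also have "\<dots> = vector [2 * cot \<alpha> * (H 1 - H (Suc (Suc i))), 0]"
      by (simp add: vec2_eq_iff H_Suc circ_ht algebra_simps)
    finally show ?case .
  qed
  then show ?thesis using Suc assms by simp
qed

lemma guide_endpoints:
  assumes "j \<le> m"
  shows "shear_matrix n *v U_left n j = U_left' n j" "shear_matrix n *v U_right n j = U_right' n j"
    "shear_matrix n *v L_left n j = L_left' n j" "shear_matrix n *v L_right n j = L_right' n j"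
proof -
  have jn: "j < n" "1 < n" using assms n_eq n_ge_3 by auto
  have h: "V (n - j) $ 2 = H j" "V (j + 1) $ 2 = H j" "K $ 2 = H 1"
    using V_left_height[OF jn(1)] V_left_height[OF jn(2)] by (simp_all add: H_def)
  show "shear_matrix n *v U_left n j = U_left' n j" "shear_matrix n *v U_right n j = U_right' n j"
    using h upper_guide_eq[OF assms]
    by (simp_all add: shear_matrix_eq vec2_eq_iff U_left_def U_left'_def U_right_def U_right'_def)
  show "shear_matrix n *v L_left n j = L_left' n j" "shear_matrix n *v L_right n j = L_right' n j"
    using h lower_guide_eq[OF assms]
    by (simp_all add: shear_matrix_eq vec2_eq_iff L_left_def L_left'_def L_right_def L_right'_def half_turn_eq)
qed

end

theorem theorem5p1:
  fixes n :: nat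
  assumes "odd n" and "3 \<le> n"
  shows "(\<exists>f. affine_automorphism (surface n) (singularities n) (atlas n) f (shear_matrix n) \<and>
              (\<forall>C \<in> horizontal_cylinders n.
                 f ` C = C \<and>
                 (\<forall>p \<in> surface n frontier_of C. f p = p) \<and>
                 (\<exists>c h \<Phi>. flat_cylinder (surface n) (atlas n) C c h \<Phi> \<and>
                          single_dehn_twist c h \<Phi> f)))
       \<and> (\<forall>j \<in> {0..(n - 1) div 2}.
            shear_matrix n *v U_left n j = U_left' n j \<and>
            shear_matrix n *v U_right n j = U_right' n j \<and>
            shear_matrix n *v L_left n j = L_left' n j \<and>
            shear_matrix n *v L_right n j = L_right' n j)"
proof -
  interpret odd_polygon n using assms by unfold_locales
  have "twist 1 ` C = C \<and> (\<forall>p \<in> surface n frontier_of C. twist 1 p = p) \<and>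
      (\<exists>c h \<Phi>. flat_cylinder (surface n) (atlas n) C c h \<Phi> \<and> single_dehn_twist c h \<Phi> (twist 1))"
    if C: "C \<in> horizontal_cylinders n" for C
  proof -
    obtain j where j: "j < m" "C = open_cyl j" using C by (rule horizontal_cylinder_cases)
    show ?thesis
      unfolding j(2)
      using twist_open_cyl[OF j(1), of 1] twist_frontier[OF j(1), of _ 1] cyl_flat[OF j(1)] twist_dehn[OF j(1)]
      by (intro conjI ballI exI)
  qed
  then show ?thesis
    using twist_affine
    by (intro conjI exI[of _ "twist 1"] ballI) (simp_all add: guide_endpoints m_def)
qed

end
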